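(* Let $f=1+\sum_{|\alpha|\ge 1} b_\alpha Z_\alpha$ be an arbitrary admissible free holomorphic function with universal model ${\bf W}^{(f)}=(W_1^{(f)},\ldots,W_n^{(f)})$, and set $$d:=\sup\left\{\frac{b_\alpha}{b_{g_i\alpha}}:\ \alpha\in\mathbb F_n^+,\ i\in\{1,\ldots,n\}\right\}.$$ Let $\mathcal K$ be a Hilbert space. Then a closed subspace $\mathcal M\subset F^2(H_n)\otimes\mathcal K$ is a joint invariant subspace under $W_1^{(f)}\otimes I_{\mathcal K},\ldots,W_n^{(f)}\otimes I_{\mathcal K}$ if and only if there is a Hilbert space $\mathcal D$ and a partial isometry $\Psi:F^2(H_n)\otimes\mathcal D\to F^2(H_n)\otimes\mathcal K$ such that $$\mathcal M=\Psi(F^2(H_n)\otimes\mathcal D)$$ and $$\sqrt d\,\Psi(S_i\otimes I_{\mathcal D})=(W_i^{(f)}\otimes I_{\mathcal K})\Psi,\qquad i\in\{1,\ldots,n\},$$ where $S_1,\ldots,S_n$ are the left creation operators on the full Fock space $F^2(H_n)$.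
   Context: Fix an integer $n\ge 1$ and an $n$-dimensional complex Hilbert space $H_n$ with orthonormal basis $e_1,\ldots,e_n$. The full Fock space is $F^2(H_n)=\bigoplus_{k\ge0}H_n^{\otimes k}$ with $H_n^{\otimes 0}=\mathbb C1$. The left creation operators are $S_i\varphi=e_i\otimes\varphi$. $\mathbb F_n^+$ is the unital free semigroup on generators $g_1,\ldots,g_n$ with identity $g_0$; $|\alpha|$ is the length of $\alpha$ ($|g_0|=0$). For $\alpha=g_{i_1}\cdots g_{i_k}$ put $e_\alpha=e_{i_1}\otimes\cdots\otimes e_{i_k}$, $e_{g_0}=1$ (so $\{e_\alpha\}$ is an orthonormal basis of $F^2(H_n)$), and for operators or indeterminates put $X_\alpha=X_{i_1}\cdots X_{i_k}$, $X_{g_0}=I$. A formal power series $f=1+\sum_{|\alpha|\ge1}b_\alpha Z_\alpha$ in noncommuting indeterminates $Z_1,\ldots,Z_n$ is an admissible free holomorphic function if: (a) $b_\alpha>0$ for all $\alpha$, $b_{g_0}=1$, and $\sup_{\alpha}\frac{b_\alpha}{b_{g_i\alpha}}<\infty$ for each $i$; (b) $\limsup_{k\to\infty}\big(\sum_{|\alpha|=k}b_\alpha^2\big)^{1/2k}<\infty$ (i.e. $f$ is free holomorphic in a neighborhood of the origin); (c) $\sup_{k}\big\|\sum_{p=0}^k\sum_{|\alpha|=p}a_\alpha W_\alpha W_\alpha^*\big\|<\infty$, where $f^{-1}=1+\sum_{|\alpha|\ge1}a_\alpha Z_\alpha$ is the inverse of $f$ as a formal power series and ${\bf W}^{(f)}=(W_1,\ldots,W_n)$,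 the universal model of $f$, is the tuple of weighted left creation operators $W_i=S_iD_i$ with $D_ie_\alpha=\sqrt{b_\alpha/b_{g_i\alpha}}\,e_\alpha$. *)

theory Defs
  imports "HOL-Analysis.Analysis"
begin

section \<open>Complex Hilbert spaces\<close>

class complex_vector = real_vector +
  fixes scaleC :: "complex \<Rightarrow> 'a \<Rightarrow> 'a"  (infixr \<open>*\<^sub>C\<close> 75)
  assumes scaleC_add_right: "c *\<^sub>C (x + y) = c *\<^sub>C x + c *\<^sub>C y"
    and scaleC_add_left: "(c + d) *\<^sub>C x = c *\<^sub>C x + d *\<^sub>C x"
    and scaleC_scaleC: "c *\<^sub>C d *\<^sub>C x = (c * d) *\<^sub>C x"
    and scaleC_of_real: "complex_of_real r *\<^sub>C x = r *\<^sub>R x"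

text \<open>
  The inner product is linear in its first argument.  Its positivity and definiteness are
  contained in \<open>norm_square_eq_cinner\<close>, because \<open>norm\<close> is a norm.
\<close>

class complex_inner = complex_vector + real_normed_vector +
  fixes cinner :: "'a \<Rightarrow> 'a \<Rightarrow> complex"
  assumes cinner_commute: "cinner x y = cnj (cinner y x)"
    and cinner_add_left: "cinner (x + y) z = cinner x z + cinner y z"
    and cinner_scaleC_left: "cinner (c *\<^sub>C x) y = c * cinner x y"
    and norm_square_eq_cinner: "complex_of_real ((norm x)\<^sup>2) = cinner x x"

class chilbert_space = complex_inner + complete_space

lemma scaleC_one [simp]: "1 *\<^sub>C x = (x :: 'a :: complex_vector)"
  using scaleC_of_real[of 1 x] by simp

global_interpretation complex_vector: vector_space "scaleC :: complex \<Rightarrow> 'a \<Rightarrow> 'a :: complex_vector"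
  by unfold_locales (simp_all add: scaleC_add_left scaleC_add_right scaleC_scaleC)

abbreviation csubspace :: "'a :: complex_vector set \<Rightarrow> bool"
  where "csubspace \<equiv> complex_vector.subspace"

definition bounded_clinear :: "('a :: complex_inner \<Rightarrow> 'b :: complex_inner) \<Rightarrow> bool"
  where "bounded_clinear T \<longleftrightarrow> bounded_linear T \<and> (\<forall>c x. T (c *\<^sub>C x) = c *\<^sub>C T x)"

lemma norm_scaleC: "norm (c *\<^sub>C x) = cmod c * norm (x :: 'a :: complex_inner)"
proof -
  have "complex_of_real ((norm (c *\<^sub>C x))\<^sup>2) = c * cnj (c * cnj (cinner x x))"
    by (metis norm_square_eq_cinner cinner_scaleC_left cinner_commute complex_cnj_cnj)
  also have "\<dots> = complex_of_real ((cmod c * norm x)\<^sup>2)"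
    by (simp add: norm_square_eq_cinner[symmetric] power_mult_distrib
      complex_norm_square[unfolded of_real_power] mult_ac)
  finally have "(norm (c *\<^sub>C x))\<^sup>2 = (cmod c * norm x)\<^sup>2"
    by (simp only: of_real_eq_iff)
  then show ?thesis by (simp add: power2_eq_iff_nonneg)
qed

lemma Re_cinner_le: "Re (cinner x y) \<le> norm x * norm (y :: 'a :: complex_inner)"
proof -
  have e: "(norm z)\<^sup>2 = Re (cinner z z)" for z :: 'a
    by (simp add: norm_square_eq_cinner[symmetric])
  have r: "cinner z (x + y) = cinner z x + cinner z y" for z :: 'a
    by (metis cinner_add_left cinner_commute complex_cnj_add)
  have "Re (cinner y x) = Re (cinner x y)" by (subst cinner_commute) simp
  then have "(norm (x + y))\<^sup>2 = (norm x)\<^sup>2 + (norm y)\<^sup>2 + 2 * Re (cinner x y)"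
    by (simp add: e r cinner_add_left)
  moreover have "(norm (x + y))\<^sup>2 \<le> (norm x + norm y)\<^sup>2"
    by (simp add: norm_triangle_ineq power_mono)
  ultimately show ?thesis by (simp add: power2_sum)
qed

lemma cmod_cinner_le: "cmod (cinner x y) \<le> norm x * norm (y :: 'a :: complex_inner)"
proof (cases "cinner x y = 0")
  case False
  define u where "u = cnj (cinner x y) / cmod (cinner x y)"
  have u: "cmod u = 1" using False by (simp add: u_def norm_divide)
  have "u * cinner x y = cmod (cinner x y)"
    using False by (simp add: u_def complex_norm_square[symmetric] power2_eq_square mult.commute)
  then have "cmod (cinner x y) = Re (cinner (u *\<^sub>C x) y)"
    by (simp add: cinner_scaleC_left)
  also have "\<dots> \<le> norm (u *\<^sub>C x) * norm y" by (rule Re_cinner_le)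
  finally show ?thesis by (simp add: norm_scaleC u)
qed simp

instantiation complex :: chilbert_space
begin

definition scaleC_complex :: "complex \<Rightarrow> complex \<Rightarrow> complex"
  where "scaleC_complex = (*)"

definition cinner_complex :: "complex \<Rightarrow> complex \<Rightarrow> complex"
  where "cinner_complex x y = x * cnj y"

instance
  by standard (simp_all add: scaleC_complex_def cinner_complex_def algebra_simps scaleR_conv_of_real
    complex_norm_square[symmetric])

end

text \<open>
  The adjoint is unique if it exists; it exists for every bounded operator on a Hilbert space.
\<close>

definition cadjoint :: "('a :: complex_inner \<Rightarrow> 'b :: complex_inner) \<Rightarrow> 'b \<Rightarrow> 'a"
  where "cadjoint T = (THE R. \<forall>x y. cinner (T x) y = cinner x (R y))"

text \<open>
  A partial isometry whose domain is the closed subspace \<open>H\<close> of the ambient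
  space: a bounded linear map on \<open>H\<close> that is isometric on the orthogonal complement, in \<open>H\<close>, of
  its kernel.  Its values outside \<open>H\<close> are irrelevant.
\<close>

definition partial_isometry_on ::
    "'a :: complex_inner set \<Rightarrow> ('a \<Rightarrow> 'b :: complex_inner) \<Rightarrow> bool"
  where "partial_isometry_on H V \<longleftrightarrow>
    (\<forall>x\<in>H. \<forall>y\<in>H. V (x + y) = V x + V y) \<and>
    (\<forall>c. \<forall>x\<in>H. V (c *\<^sub>C x) = c *\<^sub>C V x) \<and>
    (\<exists>B. \<forall>x\<in>H. norm (V x) \<le> B * norm x) \<and>
    (\<forall>x\<in>H. (\<forall>y\<in>H. V y = 0 \<longrightarrow> cinner x y = 0) \<longrightarrow> norm (V x) = norm x)"


section \<open>Square-summable families in a Hilbert space\<close>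

typedef (overloaded) ('i, 'a) ell2 =
  "{f :: 'i \<Rightarrow> 'a :: chilbert_space. (\<lambda>i. (norm (f i))\<^sup>2) summable_on UNIV}"
  morphisms ell2_nth Abs_ell2
  by (rule exI[of _ "\<lambda>_. 0"]) simp

setup_lifting type_definition_ell2

lemma ell2_eqI: "(\<And>i. ell2_nth x i = ell2_nth y i) \<Longrightarrow> x = y"
  by (simp add: ell2_nth_inject[symmetric] fun_eq_iff)

lemma L2_set_bounded_ell2:
  fixes f :: "'i \<Rightarrow> 'a :: chilbert_space"
  assumes "\<And>F. finite F \<Longrightarrow> L2_set (\<lambda>i. norm (f i)) F \<le> B"
  shows "(\<lambda>i. (norm (f i))\<^sup>2) summable_on UNIV"
    and "sqrt (\<Sum>\<^sub>\<infinity>i. (norm (f i))\<^sup>2) \<le> B"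
proof -
  have B: "0 \<le> B" using assms[of "{}"] by simp
  have le: "(\<Sum>i\<in>F. (norm (f i))\<^sup>2) \<le> B\<^sup>2" if "finite F" for F
    using assms[OF that] B by (simp add: L2_set_def real_sqrt_le_iff sqrt_le_D)
  show s: "(\<lambda>i. (norm (f i))\<^sup>2) summable_on UNIV"
    by (rule nonneg_bdd_above_summable_on) (auto intro!: bdd_aboveI2[of _ _ "B\<^sup>2"] le)
  have "(\<Sum>\<^sub>\<infinity>i. (norm (f i))\<^sup>2) \<le> B\<^sup>2"
    by (rule infsum_le_finite_sums[OF s]) (rule le)
  then show "sqrt (\<Sum>\<^sub>\<infinity>i. (norm (f i))\<^sup>2) \<le> B"
    using B by (simp add: real_le_lsqrt infsum_nonneg)
qed

lemma L2_set_le_infsum: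
  fixes f :: "'i \<Rightarrow> 'a :: chilbert_space"
  assumes "(\<lambda>i. (norm (f i))\<^sup>2) summable_on UNIV" "finite F"
  shows "L2_set (\<lambda>i. norm (f i)) F \<le> sqrt (\<Sum>\<^sub>\<infinity>i. (norm (f i))\<^sup>2)"
  unfolding L2_set_def by (simp add: finite_sum_le_infsum assms)

lemma L2_set_add_le:
  fixes f g :: "'i \<Rightarrow> 'a :: real_normed_vector"
  shows "L2_set (\<lambda>i. norm (f i + g i)) F \<le> L2_set (\<lambda>i. norm (f i)) F + L2_set (\<lambda>i. norm (g i)) F"
  by (rule order_trans[OF L2_set_mono L2_set_triangle_ineq]) (auto intro: norm_triangle_ineq)

lemma ell2_add_summable:
  fixes f g :: "'i \<Rightarrow> 'a :: chilbert_space"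
  assumes f: "(\<lambda>i. (norm (f i))\<^sup>2) summable_on UNIV"
    and g: "(\<lambda>i. (norm (g i))\<^sup>2) summable_on UNIV"
  shows "(\<lambda>i. (norm (f i + g i))\<^sup>2) summable_on UNIV"
    and "sqrt (\<Sum>\<^sub>\<infinity>i. (norm (f i + g i))\<^sup>2)
      \<le> sqrt (\<Sum>\<^sub>\<infinity>i. (norm (f i))\<^sup>2) + sqrt (\<Sum>\<^sub>\<infinity>i. (norm (g i))\<^sup>2)"
proof -
  have "L2_set (\<lambda>i. norm (f i + g i)) F
      \<le> sqrt (\<Sum>\<^sub>\<infinity>i. (norm (f i))\<^sup>2) + sqrt (\<Sum>\<^sub>\<infinity>i. (norm (g i))\<^sup>2)" if "finite F" for F
    using L2_set_add_le[of f g F] L2_set_le_infsum[OF f that] L2_set_le_infsum[OF g that]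
    by linarith
  note L2_set_bounded_ell2[OF this]
  then show "(\<lambda>i. (norm (f i + g i))\<^sup>2) summable_on UNIV"
    and "sqrt (\<Sum>\<^sub>\<infinity>i. (norm (f i + g i))\<^sup>2)
      \<le> sqrt (\<Sum>\<^sub>\<infinity>i. (norm (f i))\<^sup>2) + sqrt (\<Sum>\<^sub>\<infinity>i. (norm (g i))\<^sup>2)"
    by blast+
qed

lemma ell2_scaleC_summable:
  fixes f :: "'i \<Rightarrow> 'a :: chilbert_space"
  assumes "(\<lambda>i. (norm (f i))\<^sup>2) summable_on UNIV"
  shows "(\<lambda>i. (norm (c *\<^sub>C f i))\<^sup>2) summable_on UNIV"
  using assms by (simp add: norm_scaleC power_mult_distrib summable_on_cmult_right)

lemma cinner_abs_summable:
  fixes f g :: "'i \<Rightarrow> 'a :: chilbert_space"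
  assumes f: "(\<lambda>i. (norm (f i))\<^sup>2) summable_on UNIV"
    and g: "(\<lambda>i. (norm (g i))\<^sup>2) summable_on UNIV"
  shows "(\<lambda>i. norm (cinner (f i) (g i))) summable_on UNIV"
proof (rule summable_on_comparison_test)
  show "(\<lambda>i. (norm (f i))\<^sup>2 + (norm (g i))\<^sup>2) summable_on UNIV"
    using f g by (rule summable_on_add)
  show "norm (cinner (f i) (g i)) \<le> (norm (f i))\<^sup>2 + (norm (g i))\<^sup>2" for i
  proof -
    have "2 * (norm (f i) * norm (g i)) \<le> (norm (f i))\<^sup>2 + (norm (g i))\<^sup>2"
      using sum_squares_bound[of "norm (f i)" "norm (g i)"] by (simp add: mult_ac)
    moreover have "0 \<le> norm (f i) * norm (g i)" by simp
    ultimately show ?thesis using cmod_cinner_le[of "f i" "g i"] by linarith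
  qed
qed simp

lemma cinner_summable:
  fixes f g :: "'i \<Rightarrow> 'a :: chilbert_space"
  assumes "(\<lambda>i. (norm (f i))\<^sup>2) summable_on UNIV" "(\<lambda>i. (norm (g i))\<^sup>2) summable_on UNIV"
  shows "(\<lambda>i. cinner (f i) (g i)) summable_on UNIV"
  using cinner_abs_summable[OF assms] by (rule abs_summable_summable)

instantiation ell2 :: (type, chilbert_space) complex_inner
begin

lift_definition zero_ell2 :: "('a, 'b) ell2" is "\<lambda>_. 0"
  by simp

lift_definition plus_ell2 :: "('a, 'b) ell2 \<Rightarrow> ('a, 'b) ell2 \<Rightarrow> ('a, 'b) ell2"
  is "\<lambda>x y i. x i + y i"
  by (rule ell2_add_summable)

lift_definition scaleC_ell2 :: "complex \<Rightarrow> ('a, 'b) ell2 \<Rightarrow> ('a, 'b) ell2"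
  is "\<lambda>c x i. c *\<^sub>C x i"
  by (rule ell2_scaleC_summable)

lift_definition scaleR_ell2 :: "real \<Rightarrow> ('a, 'b) ell2 \<Rightarrow> ('a, 'b) ell2"
  is "\<lambda>r x i. r *\<^sub>R x i"
  using ell2_scaleC_summable[of _ "complex_of_real _"] by (simp add: scaleC_of_real)

lift_definition uminus_ell2 :: "('a, 'b) ell2 \<Rightarrow> ('a, 'b) ell2" is "\<lambda>x i. - x i"
  by simp

lift_definition minus_ell2 :: "('a, 'b) ell2 \<Rightarrow> ('a, 'b) ell2 \<Rightarrow> ('a, 'b) ell2"
  is "\<lambda>x y i. x i - y i"
  using ell2_add_summable(1)[of _ "\<lambda>i. - (_ i)"] by simp

lift_definition norm_ell2 :: "('a, 'b) ell2 \<Rightarrow> real"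
  is "\<lambda>x. sqrt (\<Sum>\<^sub>\<infinity>i. (norm (x i))\<^sup>2)" .

lift_definition cinner_ell2 :: "('a, 'b) ell2 \<Rightarrow> ('a, 'b) ell2 \<Rightarrow> complex"
  is "\<lambda>x y. \<Sum>\<^sub>\<infinity>i. cinner (x i) (y i)" .

definition "sgn x = inverse (norm x) *\<^sub>R (x :: ('a, 'b) ell2)"

definition "dist x y = norm (x - y :: ('a, 'b) ell2)"

definition "uniformity = (INF e\<in>{0<..}. principal {(x :: ('a, 'b) ell2, y). dist x y < e})"

definition "open (U :: ('a, 'b) ell2 set) \<longleftrightarrow>
  (\<forall>x\<in>U. \<forall>\<^sub>F (x', y) in uniformity. x' = x \<longrightarrow> y \<in> U)"

instance
proof
  fix x y z :: "('a, 'b) ell2" and r s :: real and c d :: complex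
  show "x + y + z = x + (y + z)" by transfer (simp add: add.assoc)
  show "x + y = y + x" by transfer (simp add: add.commute)
  show "0 + x = x" by transfer simp
  show "- x + x = 0" by transfer simp
  show "x - y = x + - y" by transfer simp
  show "r *\<^sub>R (x + y) = r *\<^sub>R x + r *\<^sub>R y" by transfer (simp add: scaleR_add_right)
  show "(r + s) *\<^sub>R x = r *\<^sub>R x + s *\<^sub>R x" by transfer (simp add: scaleR_add_left)
  show "r *\<^sub>R s *\<^sub>R x = (r * s) *\<^sub>R x" by transfer simp
  show "1 *\<^sub>R x = x" by transfer simp
  show "c *\<^sub>C (x + y) = c *\<^sub>C x + c *\<^sub>C y" by transfer (simp add: scaleC_add_right)
  show "(c + d) *\<^sub>C x = c *\<^sub>C x + d *\<^sub>C x" by transfer (simp add: scaleC_add_left)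
  show "c *\<^sub>C d *\<^sub>C x = (c * d) *\<^sub>C x" by transfer (simp add: scaleC_scaleC)
  show "complex_of_real r *\<^sub>C x = r *\<^sub>R x" by transfer (simp add: scaleC_of_real)
  show "dist x y = norm (x - y)" by (rule dist_ell2_def)
  show "sgn x = inverse (norm x) *\<^sub>R x" by (rule sgn_ell2_def)
  show "(uniformity :: (('a, 'b) ell2 \<times> ('a, 'b) ell2) filter)
      = (INF e\<in>{0<..}. principal {(x, y). dist x y < e})" by (rule uniformity_ell2_def)
  show "open U \<longleftrightarrow> (\<forall>x\<in>U. \<forall>\<^sub>F (x', y) in uniformity. x' = x \<longrightarrow> y \<in> U)"
    for U :: "('a, 'b) ell2 set" by (rule open_ell2_def)
  show "norm x = 0 \<longleftrightarrow> x = 0"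
  proof transfer
    fix f :: "'a \<Rightarrow> 'b" assume f: "(\<lambda>i. (norm (f i))\<^sup>2) summable_on UNIV"
    have "f i = 0" if "(\<Sum>\<^sub>\<infinity>i. (norm (f i))\<^sup>2) = 0" for i
      using finite_sum_le_infsum[OF f, of "{i}"] that by simp
    then show "sqrt (\<Sum>\<^sub>\<infinity>i. (norm (f i))\<^sup>2) = 0 \<longleftrightarrow> f = (\<lambda>_. 0)" by auto
  qed
  show "norm (x + y) \<le> norm x + norm y" by transfer (rule ell2_add_summable)
  show "norm (r *\<^sub>R x) = \<bar>r\<bar> * norm x"
    by transfer (simp add: power_mult_distrib infsum_cmult_right' real_sqrt_mult)
  show "cinner x y = cnj (cinner y x)"
  proof transfer
    fix f g :: "'a \<Rightarrow> 'b"
    show "(\<Sum>\<^sub>\<infinity>i. cinner (f i) (g i)) = cnj (\<Sum>\<^sub>\<infinity>i. cinner (g i) (f i))"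
      unfolding infsum_cnj[symmetric] by (rule infsum_cong) (rule cinner_commute)
  qed
  show "cinner (x + y) z = cinner x z + cinner y z"
    by transfer (simp add: cinner_add_left infsum_add cinner_summable)
  show "cinner (c *\<^sub>C x) y = c * cinner x y"
    by transfer (simp add: cinner_scaleC_left infsum_cmult_right')
  show "complex_of_real ((norm x)\<^sup>2) = cinner x x"
  proof transfer
    fix f :: "'a \<Rightarrow> 'b" assume f: "(\<lambda>i. (norm (f i))\<^sup>2) summable_on UNIV"
    have "((\<lambda>i. complex_of_real ((norm (f i))\<^sup>2)) has_sum
        complex_of_real (\<Sum>\<^sub>\<infinity>i. (norm (f i))\<^sup>2)) UNIV"
      using has_sum_infsum[OF f] by (rule has_sum_of_real)
    then show "complex_of_real ((sqrt (\<Sum>\<^sub>\<infinity>i. (norm (f i))\<^sup>2))\<^sup>2) = (\<Sum>\<^sub>\<infinity>i. cinner (f i) (f i))"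
      by (simp add: norm_square_eq_cinner[symmetric] infsum_nonneg infsumI)
  qed
qed

end

lemma L2_set_le_norm_ell2: "finite F \<Longrightarrow> L2_set (\<lambda>i. norm (ell2_nth x i)) F \<le> norm x"
  by transfer (rule L2_set_le_infsum)

lemma norm_ell2_nth_le: "norm (ell2_nth x i) \<le> norm x"
  using L2_set_le_norm_ell2[of "{i}" x] by simp

instance ell2 :: (type, chilbert_space) chilbert_space
proof
  fix X :: "nat \<Rightarrow> ('a, 'b) ell2"
  assume X: "Cauchy X"
  have "Cauchy (\<lambda>n. ell2_nth (X n) i)" for i
  proof (rule metric_CauchyI)
    fix e :: real assume "e > 0"
    then obtain N where N: "\<forall>m\<ge>N. \<forall>n\<ge>N. dist (X m) (X n) < e"
      using X metric_CauchyD by blast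
    have "dist (ell2_nth (X m) i) (ell2_nth (X n) i) \<le> dist (X m) (X n)" for m n
      using norm_ell2_nth_le[of "X m - X n" i] by (simp add: dist_norm minus_ell2.rep_eq)
    then show "\<exists>N. \<forall>m\<ge>N. \<forall>n\<ge>N. dist (ell2_nth (X m) i) (ell2_nth (X n) i) < e"
      using N by (meson le_less_trans)
  qed
  then have g: "(\<lambda>n. ell2_nth (X n) i) \<longlonglongrightarrow> lim (\<lambda>n. ell2_nth (X n) i)" for i
    by (simp add: Cauchy_convergent convergent_LIMSEQ_iff[symmetric])
  define g where "g i = lim (\<lambda>n. ell2_nth (X n) i)" for i
  note g = g[folded g_def]
  have bd: "\<exists>N. \<forall>n\<ge>N. \<forall>F. finite F \<longrightarrow> L2_set (\<lambda>i. norm (ell2_nth (X n) i - g i)) F \<le> e"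
    if "e > 0" for e
  proof -
    obtain N where N: "\<forall>m\<ge>N. \<forall>n\<ge>N. dist (X m) (X n) < e"
      using X \<open>e > 0\<close> metric_CauchyD by blast
    have "L2_set (\<lambda>i. norm (ell2_nth (X n) i - g i)) F \<le> e" if n: "n \<ge> N" and F: "finite F" for n F
    proof (rule tendsto_upperbound)
      show "(\<lambda>m. L2_set (\<lambda>i. norm (ell2_nth (X n) i - ell2_nth (X m) i)) F)
          \<longlonglongrightarrow> L2_set (\<lambda>i. norm (ell2_nth (X n) i - g i)) F"
        unfolding L2_set_def by (intro tendsto_intros g)
      show "\<forall>\<^sub>F m in sequentially. L2_set (\<lambda>i. norm (ell2_nth (X n) i - ell2_nth (X m) i)) F \<le> e"
        using eventually_ge_at_top[of N]
      proof eventually_elim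
        case (elim m)
        have "dist (X n) (X m) < e" using N n elim by blast
        then show ?case
          using L2_set_le_norm_ell2[OF F, of "X n - X m"] by (simp add: dist_norm minus_ell2.rep_eq)
      qed
    qed simp
    then show ?thesis by blast
  qed
  have s: "(\<lambda>i. (norm (g i))\<^sup>2) summable_on UNIV"
  proof -
    obtain N where "\<forall>F. finite F \<longrightarrow> L2_set (\<lambda>i. norm (ell2_nth (X N) i - g i)) F \<le> 1"
      using bd[of 1] by auto
    then have "(\<lambda>i. (norm (ell2_nth (X N) i - g i))\<^sup>2) summable_on UNIV"
      by (intro L2_set_bounded_ell2) auto
    moreover have "(\<lambda>i. (norm (ell2_nth (X N) i))\<^sup>2) summable_on UNIV"
      using ell2_nth[of "X N"] by simp
    ultimately have "(\<lambda>i. (norm (- (ell2_nth (X N) i - g i) + ell2_nth (X N) i))\<^sup>2) summable_on UNIV"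
      by (intro ell2_add_summable) (simp_all add: norm_minus_commute)
    then show ?thesis by simp
  qed
  define L where "L = Abs_ell2 g"
  have L: "ell2_nth L = g" using s by (simp add: L_def Abs_ell2_inverse)
  have "X \<longlonglongrightarrow> L"
  proof (rule metric_LIMSEQ_I)
    fix e :: real assume "e > 0"
    then obtain N where N: "\<forall>n\<ge>N. \<forall>F. finite F \<longrightarrow>
        L2_set (\<lambda>i. norm (ell2_nth (X n) i - g i)) F \<le> e / 2"
      using bd[of "e / 2"] by auto
    have "dist (X n) L \<le> e / 2" if "n \<ge> N" for n
      unfolding dist_norm norm_ell2.rep_eq
      by (rule L2_set_bounded_ell2) (use N that in \<open>simp add: minus_ell2.rep_eq L\<close>)
    then show "\<exists>N. \<forall>n\<ge>N. dist (X n) L < e" using \<open>e > 0\<close> by (intro exI[of _ N]) fastforce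
  qed
  then show "convergent X" by (auto simp: convergent_def)
qed


section \<open>The full Fock space and its Hilbert tensor products\<close>

text \<open>
  The generators of the free semigroup, equivalently the basis vectors of $H_n$, are the elements
  of a finite type \<open>'n\<close>, so that \<open>n = CARD('n) \<ge> 1\<close>; the semigroup elements are the lists
  over \<open>'n\<close>, and $g_i \alpha$ is \<open>i # \<alpha>\<close>.

  A vector of the full Fock space $F^2(H_n)$ is given by its coefficients with respect to the
  orthonormal basis $e_\alpha$; thus $F^2(H_n)$ is \<open>('n, complex) fock\<close>.  The Hilbert tensor
  product of $F^2(H_n)$ with \<open>'k\<close> is \<open>('n, 'k) fock\<close>, the vector
  $\sum_\alpha e_\alpha \otimes k_\alpha$ being the family of the $k_\alpha$: see
  \<open>cinner_otimes\<close> and \<open>has_sum_basis\<close> below.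
\<close>

type_synonym ('n, 'k) fock = "('n list, 'k) ell2"

lift_definition otimes :: "('n, complex) fock \<Rightarrow> 'k :: chilbert_space \<Rightarrow> ('n, 'k) fock"
    (infixr \<open>\<otimes>\<^sub>F\<close> 75)
  is "\<lambda>x k \<alpha>. x \<alpha> *\<^sub>C k"
  by (simp add: norm_scaleC power_mult_distrib summable_on_cmult_left)

lift_definition fock_basis :: "'n list \<Rightarrow> ('n, complex) fock"
  is "\<lambda>\<alpha> \<beta>. if \<beta> = \<alpha> then 1 else 0"
proof -
  fix \<alpha> :: "'n list"
  have "(\<lambda>\<beta>. (norm (if \<beta> = \<alpha> then 1 else 0 :: complex))\<^sup>2) summable_on {\<alpha>}" by simp
  then show "(\<lambda>\<beta>. (norm (if \<beta> = \<alpha> then 1 else 0 :: complex))\<^sup>2) summable_on UNIV"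
    by (rule summable_on_cong_neutral[THEN iffD1, rotated -1]) auto
qed

lemma cinner_otimes:
  fixes k l :: "'k :: chilbert_space" and x y :: "('n, complex) fock"
  shows "cinner (x \<otimes>\<^sub>F k) (y \<otimes>\<^sub>F l) = cinner x y * cinner k l"
proof -
  have "cinner (a *\<^sub>C k) (c *\<^sub>C l) = cinner a c * cinner k l" for a c :: complex
  proof -
    have "cinner k (c *\<^sub>C l) = cnj (c * cinner l k)"
      by (subst cinner_commute) (simp only: cinner_scaleC_left)
    also have "\<dots> = cnj c * cinner k l"
      by (subst cinner_commute[of k l]) (simp only: complex_cnj_mult)
    finally show ?thesis
      by (simp only: cinner_scaleC_left cinner_complex_def mult.assoc)
  qed
  then show ?thesis
    by (simp only: cinner_ell2.rep_eq otimes.rep_eq infsum_cmult_left')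
qed

lemma ell2_nth_sum: "ell2_nth (sum f F) i = (\<Sum>j\<in>F. ell2_nth (f j) i)"
  by (induction F rule: infinite_finite_induct) (simp_all add: zero_ell2.rep_eq plus_ell2.rep_eq)

lemma has_sum_basis: "((\<lambda>\<alpha>. fock_basis \<alpha> \<otimes>\<^sub>F ell2_nth \<phi> \<alpha>) has_sum \<phi>) UNIV"
proof -
  let ?s = "\<lambda>F. \<Sum>\<alpha>\<in>F. fock_basis \<alpha> \<otimes>\<^sub>F ell2_nth \<phi> \<alpha>"
  let ?S = "\<Sum>\<^sub>\<infinity>\<alpha>. (norm (ell2_nth \<phi> \<alpha>))\<^sup>2"
  have sm: "(\<lambda>\<alpha>. (norm (ell2_nth \<phi> \<alpha>))\<^sup>2) summable_on UNIV" using ell2_nth[of \<phi>] by simp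
  have nth: "ell2_nth (?s F) \<beta> = (if \<beta> \<in> F then ell2_nth \<phi> \<beta> else 0)" if "finite F" for F \<beta>
  proof -
    have "ell2_nth (?s F) \<beta> = (\<Sum>\<alpha>\<in>F. if \<alpha> = \<beta> then ell2_nth \<phi> \<beta> else 0)"
      unfolding ell2_nth_sum by (rule sum.cong) (auto simp: otimes.rep_eq fock_basis.rep_eq)
    also have "\<dots> = (if \<beta> \<in> F then ell2_nth \<phi> \<beta> else 0)" using that by simp
    finally show ?thesis .
  qed
  have nrm: "norm (?s F - \<phi>) \<le> sqrt (?S - (\<Sum>\<alpha>\<in>F. (norm (ell2_nth \<phi> \<alpha>))\<^sup>2))"
    if F: "finite F" for F
    unfolding norm_ell2.rep_eq
  proof (rule L2_set_bounded_ell2)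
    fix G :: "'a list set" assume G: "finite G"
    have "(\<Sum>\<alpha>\<in>G. (norm (ell2_nth (?s F - \<phi>) \<alpha>))\<^sup>2) = (\<Sum>\<alpha>\<in>G - F. (norm (ell2_nth \<phi> \<alpha>))\<^sup>2)"
      by (rule sum.mono_neutral_cong_right) (auto simp: minus_ell2.rep_eq nth[OF F] G)
    also have "\<dots> + (\<Sum>\<alpha>\<in>F. (norm (ell2_nth \<phi> \<alpha>))\<^sup>2)
        = (\<Sum>\<alpha>\<in>(G - F) \<union> F. (norm (ell2_nth \<phi> \<alpha>))\<^sup>2)"
      by (rule sum.union_disjoint[symmetric]) (use F G in auto)
    also have "\<dots> \<le> ?S" by (rule finite_sum_le_infsum[OF sm]) (use F G in auto)
    finally show "L2_set (\<lambda>\<alpha>. norm (ell2_nth (?s F - \<phi>) \<alpha>)) G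
        \<le> sqrt (?S - (\<Sum>\<alpha>\<in>F. (norm (ell2_nth \<phi> \<alpha>))\<^sup>2))"
      unfolding L2_set_def by (simp add: algebra_simps)
  qed
  have lim: "((\<lambda>F. \<Sum>\<alpha>\<in>F. (norm (ell2_nth \<phi> \<alpha>))\<^sup>2) \<longlongrightarrow> ?S) (finite_subsets_at_top UNIV)"
    using has_sum_infsum[OF sm] by (simp add: has_sum_def)
  have "((\<lambda>F. sqrt (?S - (\<Sum>\<alpha>\<in>F. (norm (ell2_nth \<phi> \<alpha>))\<^sup>2))) \<longlongrightarrow> sqrt (?S - ?S))
      (finite_subsets_at_top UNIV)"
    by (intro tendsto_intros lim)
  then have null: "((\<lambda>F. sqrt (?S - (\<Sum>\<alpha>\<in>F. (norm (ell2_nth \<phi> \<alpha>))\<^sup>2))) \<longlongrightarrow> 0)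
      (finite_subsets_at_top UNIV)"
    by simp
  have "\<forall>\<^sub>F F in finite_subsets_at_top UNIV.
      norm (?s F - \<phi>) \<le> sqrt (?S - (\<Sum>\<alpha>\<in>F. (norm (ell2_nth \<phi> \<alpha>))\<^sup>2))"
    by (rule eventually_finite_subsets_at_top_weakI) (rule nrm)
  from this null have "((\<lambda>F. ?s F - \<phi>) \<longlongrightarrow> 0) (finite_subsets_at_top UNIV)"
    by (rule Lim_null_comparison)
  then have "(?s \<longlongrightarrow> \<phi>) (finite_subsets_at_top UNIV)" by (rule LIM_zero_cancel)
  then show ?thesis unfolding has_sum_def .
qed

text \<open>
  The operator $A \otimes I$, for an operator $A$ on $F^2(H_n)$.  For the operators needed here,
  existence is shown by \<open>tensor_id_weighted_shift\<close> below.
\<close>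

definition tensor_id ::
    "(('n, complex) fock \<Rightarrow> ('n, complex) fock) \<Rightarrow> ('n, 'k :: chilbert_space) fock \<Rightarrow> ('n, 'k) fock"
  where "tensor_id A = (THE T. bounded_clinear T \<and> (\<forall>x k. T (x \<otimes>\<^sub>F k) = A x \<otimes>\<^sub>F k))"

lemma tensor_id_eqI:
  fixes T :: "('n, 'k :: chilbert_space) fock \<Rightarrow> ('n, 'k) fock"
  assumes T: "bounded_clinear T" "\<And>x k. T (x \<otimes>\<^sub>F k) = A x \<otimes>\<^sub>F k"
  shows "tensor_id A = T"
  unfolding tensor_id_def
proof (rule the_equality)
  fix R :: "('n, 'k) fock \<Rightarrow> ('n, 'k) fock"
  assume R: "bounded_clinear R \<and> (\<forall>x k. R (x \<otimes>\<^sub>F k) = A x \<otimes>\<^sub>F k)"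
  show "R = T"
  proof
    fix \<phi> :: "('n, 'k) fock"
    have "((\<lambda>\<alpha>. A (fock_basis \<alpha>) \<otimes>\<^sub>F ell2_nth \<phi> \<alpha>) has_sum R \<phi>) UNIV"
      using has_sum_bounded_linear[OF _ has_sum_basis[of \<phi>], of R] R
      by (simp add: bounded_clinear_def o_def)
    moreover have "((\<lambda>\<alpha>. A (fock_basis \<alpha>) \<otimes>\<^sub>F ell2_nth \<phi> \<alpha>) has_sum T \<phi>) UNIV"
      using has_sum_bounded_linear[OF _ has_sum_basis[of \<phi>], of T] T
      by (simp add: bounded_clinear_def o_def)
    ultimately show "R \<phi> = T \<phi>" by (rule has_sum_unique)
  qed
qed (use T in blast)

text \<open>The subspace $F^2(H_n) \otimes D$ of \<open>('n, 'd) fock\<close>, for a closed subspace $D$ of \<open>'d\<close>.\<close>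

definition fock_tensor :: "'d :: chilbert_space set \<Rightarrow> ('n, 'd) fock set"
  where "fock_tensor D = {\<phi>. \<forall>\<alpha>. ell2_nth \<phi> \<alpha> \<in> D}"


section \<open>Admissible free holomorphic functions and their universal models\<close>

text \<open>
  A formal power series in noncommuting indeterminates is the family of its coefficients,
  indexed by words.
\<close>

definition nc_one :: "'n list \<Rightarrow> real"
  where "nc_one \<alpha> = (if \<alpha> = [] then 1 else 0)"

definition nc_mult :: "('n list \<Rightarrow> real) \<Rightarrow> ('n list \<Rightarrow> real) \<Rightarrow> 'n list \<Rightarrow> real"
  where "nc_mult f g \<alpha> = (\<Sum>k\<le>length \<alpha>. f (take k \<alpha>) * g (drop k \<alpha>))"

lemma nc_mult_one: "nc_mult f nc_one = f" "nc_mult nc_one f = f"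
proof -
  show "nc_mult f nc_one = f"
  proof
    fix \<alpha> :: "'a list"
    have "nc_mult f nc_one \<alpha> = (\<Sum>k\<le>length \<alpha>. if k = length \<alpha> then f \<alpha> else 0)"
      unfolding nc_mult_def by (rule sum.cong) (auto simp: nc_one_def)
    then show "nc_mult f nc_one \<alpha> = f \<alpha>" by simp
  qed
  show "nc_mult nc_one f = f"
  proof
    fix \<alpha> :: "'a list"
    have "nc_mult nc_one f \<alpha> = (\<Sum>k\<le>length \<alpha>. if k = 0 then f \<alpha> else 0)"
      unfolding nc_mult_def by (rule sum.cong) (auto simp: nc_one_def)
    then show "nc_mult nc_one f \<alpha> = f \<alpha>" by simp
  qed
qed

lemma nc_mult_assoc: "nc_mult (nc_mult f g) h = nc_mult f (nc_mult g h)"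
proof
  fix \<alpha> :: "'a list"
  let ?n = "length \<alpha>"
  have "nc_mult (nc_mult f g) h \<alpha> =
      (\<Sum>k\<le>?n. \<Sum>j\<le>k. f (take j \<alpha>) * g (drop j (take k \<alpha>)) * h (drop k \<alpha>))"
    unfolding nc_mult_def sum_distrib_right
    by (intro sum.cong refl) (auto simp: min_def)
  also have "\<dots> = (\<Sum>(k, j)\<in>(SIGMA k:{..?n}. {..k}).
      f (take j \<alpha>) * g (drop j (take k \<alpha>)) * h (drop k \<alpha>))"
    by (rule sum.Sigma) auto
  also have "\<dots> = (\<Sum>(j, m)\<in>(SIGMA j:{..?n}. {..?n - j}).
      f (take j \<alpha>) * (g (take m (drop j \<alpha>)) * h (drop m (drop j \<alpha>))))"
    by (rule sum.reindex_bij_witness[where i = "\<lambda>(j, m). (j + m, j)" and j = "\<lambda>(k, j). (j, k - j)"])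
      (auto simp: take_drop)
  also have "\<dots> = (\<Sum>j\<le>?n. \<Sum>m\<le>?n - j.
      f (take j \<alpha>) * (g (take m (drop j \<alpha>)) * h (drop m (drop j \<alpha>))))"
    by (rule sum.Sigma[symmetric]) auto
  also have "\<dots> = nc_mult f (nc_mult g h) \<alpha>"
    by (simp add: nc_mult_def sum_distrib_left)
  finally show "nc_mult (nc_mult f g) h \<alpha> = nc_mult f (nc_mult g h) \<alpha>" .
qed

text \<open>The one-sided inverses only serve to show that \<open>nc_inverse\<close> is well defined.\<close>

function nc_right_inverse :: "('n list \<Rightarrow> real) \<Rightarrow> 'n list \<Rightarrow> real"
  where "nc_right_inverse f \<alpha> = (if \<alpha> = [] then 1 else
    - (\<Sum>k\<in>{1..length \<alpha>}. f (take k \<alpha>) * nc_right_inverse f (drop k \<alpha>)))"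
  by auto
termination by (relation "Wellfounded.measure (\<lambda>(f, \<alpha>). length \<alpha>)") auto

function nc_left_inverse :: "('n list \<Rightarrow> real) \<Rightarrow> 'n list \<Rightarrow> real"
  where "nc_left_inverse f \<alpha> = (if \<alpha> = [] then 1 else
    - (\<Sum>k\<in>{..<length \<alpha>}. nc_left_inverse f (take k \<alpha>) * f (drop k \<alpha>)))"
  by auto
termination by (relation "Wellfounded.measure (\<lambda>(f, \<alpha>). length \<alpha>)") auto

declare nc_right_inverse.simps [simp del] nc_left_inverse.simps [simp del]

definition nc_inverse :: "('n list \<Rightarrow> real) \<Rightarrow> 'n list \<Rightarrow> real"
  where "nc_inverse f = (THE g. nc_mult f g = nc_one \<and> nc_mult g f = nc_one)"

lemma shift_ell2:
  fixes f :: "'n list \<Rightarrow> 'k :: chilbert_space" and i :: 'n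
  assumes f: "(\<lambda>\<alpha>. (norm (f \<alpha>))\<^sup>2) summable_on UNIV"
  defines "g \<equiv> \<lambda>\<beta>. case \<beta> of [] \<Rightarrow> 0 | j # \<alpha> \<Rightarrow> if j = i then f \<alpha> else 0"
  shows "(\<lambda>\<beta>. (norm (g \<beta>))\<^sup>2) summable_on UNIV"
    and "(\<Sum>\<^sub>\<infinity>\<beta>. (norm (g \<beta>))\<^sup>2) = (\<Sum>\<^sub>\<infinity>\<alpha>. (norm (f \<alpha>))\<^sup>2)"
proof -
  have "((\<lambda>\<beta>. (norm (g \<beta>))\<^sup>2) \<circ> (#) i has_sum (\<Sum>\<^sub>\<infinity>\<alpha>. (norm (f \<alpha>))\<^sup>2)) UNIV"
    using has_sum_infsum[OF f] by (simp add: g_def o_def)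
  then have "((\<lambda>\<beta>. (norm (g \<beta>))\<^sup>2) has_sum (\<Sum>\<^sub>\<infinity>\<alpha>. (norm (f \<alpha>))\<^sup>2)) (range ((#) i))"
    by (subst has_sum_reindex) auto
  then have "((\<lambda>\<beta>. (norm (g \<beta>))\<^sup>2) has_sum (\<Sum>\<^sub>\<infinity>\<alpha>. (norm (f \<alpha>))\<^sup>2)) UNIV"
    by (rule has_sum_cong_neutral[THEN iffD1, rotated -1]) (auto simp: g_def split: list.splits)
  then show "(\<lambda>\<beta>. (norm (g \<beta>))\<^sup>2) summable_on UNIV"
    and "(\<Sum>\<^sub>\<infinity>\<beta>. (norm (g \<beta>))\<^sup>2) = (\<Sum>\<^sub>\<infinity>\<alpha>. (norm (f \<alpha>))\<^sup>2)"
    by (auto simp: summable_on_def infsumI)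
qed

text \<open>$S_i e_\alpha = e_i \otimes e_\alpha = e_{g_i\alpha}$.\<close>

lift_definition left_creation :: "'n \<Rightarrow> ('n, complex) fock \<Rightarrow> ('n, complex) fock"
  is "\<lambda>i \<phi> \<beta>. case \<beta> of [] \<Rightarrow> 0 | j # \<alpha> \<Rightarrow> if j = i then \<phi> \<alpha> else 0"
  by (rule shift_ell2)

text \<open>
  The following are the diagonal operators $D_i$ and the weighted left creation operators
  $W_i = S_i D_i$ of the universal model.  The family in the definition of \<open>model_diag\<close> is
  square-summable because the weights are bounded, by condition (a) of admissibility.
\<close>

definition model_diag :: "('n list \<Rightarrow> real) \<Rightarrow> 'n \<Rightarrow> ('n, complex) fock \<Rightarrow> ('n, complex) fock"
  where "model_diag b i \<phi> =
    Abs_ell2 (\<lambda>\<alpha>. complex_of_real (sqrt (b \<alpha> / b (i # \<alpha>))) * ell2_nth \<phi> \<alpha>)"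

definition universal_model ::
    "('n list \<Rightarrow> real) \<Rightarrow> 'n \<Rightarrow> ('n, complex) fock \<Rightarrow> ('n, complex) fock"
  where "universal_model b i = left_creation i \<circ> model_diag b i"

lemma tensor_id_weighted_shift:
  fixes \<phi> :: "('n, 'k :: chilbert_space) fock"
  assumes A: "\<And>x \<beta>. ell2_nth (A x) \<beta> =
      (case \<beta> of [] \<Rightarrow> 0 | j # \<alpha> \<Rightarrow> if j = i then complex_of_real (w \<alpha>) * ell2_nth x \<alpha> else 0)"
    and w: "\<And>\<alpha>. \<bar>w \<alpha>\<bar> \<le> C"
  shows "ell2_nth (tensor_id A \<phi>) \<beta> =
      (case \<beta> of [] \<Rightarrow> 0 | j # \<alpha> \<Rightarrow> if j = i then w \<alpha> *\<^sub>R ell2_nth \<phi> \<alpha> else 0)"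
proof -
  define T :: "('n, 'k) fock \<Rightarrow> ('n, 'k) fock" where "T = (\<lambda>x. Abs_ell2 (\<lambda>\<beta>.
      case \<beta> of [] \<Rightarrow> 0 | j # \<alpha> \<Rightarrow> if j = i then w \<alpha> *\<^sub>R ell2_nth x \<alpha> else 0))"
  have C: "0 \<le> C" using w[of "[]"] by linarith
  have le: "L2_set (\<lambda>\<alpha>. norm (w \<alpha> *\<^sub>R ell2_nth x \<alpha>)) F \<le> C * norm x"
    if F: "finite F" for x :: "('n, 'k) fock" and F
  proof -
    have "L2_set (\<lambda>\<alpha>. norm (w \<alpha> *\<^sub>R ell2_nth x \<alpha>)) F \<le> L2_set (\<lambda>\<alpha>. C * norm (ell2_nth x \<alpha>)) F"
      by (rule L2_set_mono) (auto intro!: mult_right_mono w)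
    also have "\<dots> = C * L2_set (\<lambda>\<alpha>. norm (ell2_nth x \<alpha>)) F"
      by (simp add: L2_set_right_distrib C)
    also have "\<dots> \<le> C * norm x" by (intro mult_left_mono L2_set_le_norm_ell2 F C)
    finally show ?thesis .
  qed
  have T: "ell2_nth (T x) =
      (\<lambda>\<beta>. case \<beta> of [] \<Rightarrow> 0 | j # \<alpha> \<Rightarrow> if j = i then w \<alpha> *\<^sub>R ell2_nth x \<alpha> else 0)" for x
    unfolding T_def
    by (rule Abs_ell2_inverse) (use shift_ell2(1)[OF L2_set_bounded_ell2(1)[OF le]] in simp)
  have nT: "norm (T x) \<le> norm x * C" for x
  proof -
    let ?f = "\<lambda>\<alpha>. w \<alpha> *\<^sub>R ell2_nth x \<alpha>"
    have "norm (T x) = sqrt (\<Sum>\<^sub>\<infinity>\<alpha>. (norm (?f \<alpha>))\<^sup>2)"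
      unfolding norm_ell2.rep_eq T
      by (rule arg_cong[where f = sqrt], rule shift_ell2(2)) (rule L2_set_bounded_ell2(1)[OF le])
    also have "\<dots> \<le> C * norm x" by (rule L2_set_bounded_ell2(2)) (rule le)
    finally show ?thesis by (simp add: mult.commute)
  qed
  have "bounded_clinear T"
    unfolding bounded_clinear_def
  proof (intro conjI allI)
    show "bounded_linear T"
    proof (rule bounded_linear_intro[OF _ _ nT])
      show "T (x + y) = T x + T y" for x y
        by (rule ell2_eqI) (simp add: T plus_ell2.rep_eq scaleR_add_right split: list.split)
      show "T (r *\<^sub>R x) = r *\<^sub>R T x" for r x
        by (rule ell2_eqI) (simp add: T scaleR_ell2.rep_eq split: list.split)
    qed
    show "T (c *\<^sub>C x) = c *\<^sub>C T x" for c x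
      by (rule ell2_eqI) (simp add: T scaleC_ell2.rep_eq scaleC_of_real[symmetric] scaleC_scaleC
        mult.commute split: list.split)
  qed
  moreover have "T (x \<otimes>\<^sub>F k) = A x \<otimes>\<^sub>F k" for x k
    by (rule ell2_eqI) (simp add: T A otimes.rep_eq scaleC_of_real[symmetric] scaleC_scaleC
      split: list.split)
  ultimately have "tensor_id A = T" by (rule tensor_id_eqI)
  then show ?thesis by (simp add: T)
qed

lemma tensor_id_left_creation:
  "ell2_nth (tensor_id (left_creation i) \<phi>) \<beta> =
    (case \<beta> of [] \<Rightarrow> 0 | j # \<alpha> \<Rightarrow> if j = i then ell2_nth \<phi> \<alpha> else 0)"
  by (subst tensor_id_weighted_shift[where w = "\<lambda>_. 1" and C = 1 and i = i])
    (simp_all add: left_creation.rep_eq split: list.split)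

lemma tensor_id_universal_model:
  assumes "\<And>\<alpha>. b \<alpha> > 0" and "bdd_above (range (\<lambda>\<alpha>. b \<alpha> / b (i # \<alpha>)))"
  shows "ell2_nth (tensor_id (universal_model b i) \<phi>) \<beta> =
    (case \<beta> of [] \<Rightarrow> 0 | j # \<alpha> \<Rightarrow>
      if j = i then sqrt (b \<alpha> / b (i # \<alpha>)) *\<^sub>R ell2_nth \<phi> \<alpha> else 0)"
proof -
  obtain C where C: "b \<alpha> / b (i # \<alpha>) \<le> C" for \<alpha>
    using assms(2) by (auto simp: bdd_above_def)
  have w: "\<bar>sqrt (b \<alpha> / b (i # \<alpha>))\<bar> \<le> sqrt C" for \<alpha>
    using C[of \<alpha>] assms(1)[of \<alpha>] assms(1)[of "i # \<alpha>"] by simp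
  have C0: "0 \<le> sqrt C" using w[of "[]"] by linarith
  have D: "ell2_nth (model_diag b i x) =
      (\<lambda>\<alpha>. complex_of_real (sqrt (b \<alpha> / b (i # \<alpha>))) * ell2_nth x \<alpha>)" for x
    unfolding model_diag_def
  proof (rule Abs_ell2_inverse)
    let ?f = "\<lambda>\<alpha>. complex_of_real (sqrt (b \<alpha> / b (i # \<alpha>))) * ell2_nth x \<alpha>"
    have "L2_set (\<lambda>\<alpha>. norm (?f \<alpha>)) F \<le> sqrt C * norm x" if F: "finite F" for F
    proof -
      have "L2_set (\<lambda>\<alpha>. norm (?f \<alpha>)) F \<le> L2_set (\<lambda>\<alpha>. sqrt C * norm (ell2_nth x \<alpha>)) F"
        unfolding norm_mult norm_of_real by (rule L2_set_mono) (auto intro!: mult_right_mono w)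
      also have "\<dots> = sqrt C * L2_set (\<lambda>\<alpha>. norm (ell2_nth x \<alpha>)) F"
        using C0 by (simp add: L2_set_right_distrib)
      also have "\<dots> \<le> sqrt C * norm x" by (intro mult_left_mono L2_set_le_norm_ell2 F C0)
      finally show ?thesis .
    qed
    then show "?f \<in> {f. (\<lambda>\<alpha>. (norm (f \<alpha>))\<^sup>2) summable_on UNIV}"
      using L2_set_bounded_ell2(1)[of ?f] by blast
  qed
  show ?thesis
    by (rule tensor_id_weighted_shift[OF _ w])
      (simp add: universal_model_def left_creation.rep_eq D split: list.split)
qed

primrec word_op :: "('n \<Rightarrow> 'a \<Rightarrow> 'a) \<Rightarrow> 'n list \<Rightarrow> 'a \<Rightarrow> 'a"
  where
    "word_op X [] = id"
  | "word_op X (i # \<alpha>) = X i \<circ> word_op X \<alpha>"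

definition admissible :: "('n :: finite list \<Rightarrow> real) \<Rightarrow> bool"
  where "admissible b \<longleftrightarrow>
    (\<forall>\<alpha>. b \<alpha> > 0) \<and> b [] = 1 \<and> (\<forall>i. bdd_above (range (\<lambda>\<alpha>. b \<alpha> / b (i # \<alpha>)))) \<and>
    limsup (\<lambda>k. ereal ((\<Sum>\<alpha> | length \<alpha> = k. (b \<alpha>)\<^sup>2) powr (1 / (2 * real k)))) < \<infinity> \<and>
    bdd_above (range (\<lambda>k. onorm (\<lambda>\<phi>. \<Sum>p\<le>k. \<Sum>\<alpha> | length \<alpha> = p.
      nc_inverse b \<alpha> *\<^sub>R
        word_op (universal_model b) \<alpha> (cadjoint (word_op (universal_model b) \<alpha>) \<phi>))))"

end

theory Submission
  imports Defs
begin

text \<open>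
  The weights make $T_i = W_i / \sqrt d$ a row contraction on $F^2(H_n) \otimes K$.  It has an explicit
  dilation to the pure row isometry $V_i$ on $\ell^2(\mathbb F_n^+ \times \mathbb N) \otimes K$
  sending $(\gamma, k)$ to $(g_i\gamma, k + 1)$: there is a coisometry $P$ with $P V_i = T_i P$.  If
  $M$ is invariant, then $N = P^{-1}(M)$ is a closed invariant subspace for $V$, so the Wold
  decomposition (Beurling's theorem) yields a unitary $\Phi : F^2(H_n) \otimes D \to N$ with
  $\Phi (S_i \otimes I) = V_i \Phi$, where $D$ is the wandering subspace of $N$.  Because $N$ contains
  the kernel of $P$, the map $\Psi = P \Phi$ is a partial isometry onto $M$.
\<close>

section \<open>Orthogonality in complex Hilbert spaces\<close>

\<comment> \<open>The ranges of the W_i are mutually orthogonal, so the sum of the W_i W_i^* is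
  diagonal, with entry b_\<alpha> / b_{g_i \<alpha>} at e_{g_i \<alpha>}; its norm is d, which is
  the origin of the factor sqrt d. That N contains ker P matters as follows: a vector orthogonal to
  ker(P \<Phi>) is carried by \<Phi> to a vector orthogonal to all of ker P, and there a coisometry
  preserves norms. For a smaller N, orthogonality would be known only against the part of ker P
  inside N.\<close>
subclass (in chilbert_space) banach ..

lemma cinner_add_right: "cinner x (y + z) = cinner x y + cinner x (z :: 'a :: complex_inner)"
  by (metis cinner_add_left cinner_commute complex_cnj_add)

lemma cinner_scaleC_right: "cinner x (c *\<^sub>C y) = cnj c * cinner x (y :: 'a :: complex_inner)"
  by (metis cinner_commute cinner_scaleC_left complex_cnj_mult)

lemma cinner_scaleR_left: "cinner (r *\<^sub>R x) y = of_real r * cinner x (y :: 'a :: complex_inner)"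
  by (metis cinner_scaleC_left scaleC_of_real)

lemma cinner_scaleR_right: "cinner x (r *\<^sub>R y) = of_real r * cinner x (y :: 'a :: complex_inner)"
  by (metis cinner_scaleC_right scaleC_of_real complex_cnj_complex_of_real)

lemma bounded_linear_cinner_left: "bounded_linear (\<lambda>x :: 'a :: complex_inner. cinner x y)"
  by (rule bounded_linear_intro[where K = "norm y"])
    (simp_all add: cinner_add_left cinner_scaleR_left scaleR_conv_of_real cmod_cinner_le)

lemma bounded_linear_cinner_right: "bounded_linear (\<lambda>y :: 'a :: complex_inner. cinner x y)"
  by (rule bounded_linear_intro[where K = "norm x"])
    (simp_all add: cinner_add_right cinner_scaleR_right scaleR_conv_of_real cmod_cinner_le
      mult.commute[of "norm _" "norm x"])

lemmas cinner_zero_left [simp] = linear_0[OF bounded_linear.linear[OF bounded_linear_cinner_left]]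
lemmas cinner_zero_right [simp] = linear_0[OF bounded_linear.linear[OF bounded_linear_cinner_right]]
lemmas cinner_diff_right = linear_diff[OF bounded_linear.linear[OF bounded_linear_cinner_right]]
lemmas cinner_sum_left = linear_sum[OF bounded_linear.linear[OF bounded_linear_cinner_left]]
lemmas cinner_sum_right = linear_sum[OF bounded_linear.linear[OF bounded_linear_cinner_right]]

lemma cinner_eq_0_commute: "cinner x y = 0 \<longleftrightarrow> cinner y (x :: 'a :: complex_inner) = 0"
  by (metis cinner_commute complex_cnj_zero)

lemma cinner_self_eq_0 [simp]: "cinner x x = 0 \<longleftrightarrow> x = (0 :: 'a :: complex_inner)"
  by (simp flip: norm_square_eq_cinner)

lemma norm_add_square:
  "(norm (x + y))\<^sup>2 = (norm x)\<^sup>2 + (norm y)\<^sup>2 + 2 * Re (cinner x (y :: 'a :: complex_inner))"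
proof -
  have e: "(norm z)\<^sup>2 = Re (cinner z z)" for z :: 'a
    by (simp flip: norm_square_eq_cinner)
  have "Re (cinner y x) = Re (cinner x y)" by (subst cinner_commute) simp
  then show ?thesis by (simp add: e cinner_add_left cinner_add_right)
qed

lemma norm_diff_square:
  "(norm (x - y))\<^sup>2 = (norm x)\<^sup>2 + (norm y)\<^sup>2 - 2 * Re (cinner x (y :: 'a :: complex_inner))"
  using norm_add_square[of x "- y"] cinner_diff_right[of x 0 y] by simp

section \<open>Orthogonal series\<close>

lemma norm_sum_square_orthogonal:
  fixes f :: "'i \<Rightarrow> 'a :: complex_inner"
  assumes "finite F" and "\<And>i j. i \<noteq> j \<Longrightarrow> cinner (f i) (f j) = 0"
  shows "(norm (sum f F))\<^sup>2 = (\<Sum>i\<in>F. (norm (f i))\<^sup>2)"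
  using assms(1)
proof (induction F rule: finite_induct)
  case (insert i F)
  have "cinner (f i) (sum f F) = 0"
    unfolding cinner_sum_right using insert.hyps by (intro sum.neutral ballI assms(2)) auto
  then show ?case using insert by (simp add: norm_add_square)
qed simp

text \<open>By Pythagoras, two partial sums over finite sets containing \<open>F0\<close> differ
  only by tails of the series of squared norms. Hence the net of partial sums is Cauchy, and
  completeness gives a limit.\<close>

lemma summable_on_orthogonal:
  fixes f :: "'i \<Rightarrow> 'a :: chilbert_space"
  assumes orth: "\<And>i j. i \<noteq> j \<Longrightarrow> cinner (f i) (f j) = 0"
    and sm: "(\<lambda>i. (norm (f i))\<^sup>2) summable_on UNIV"
  shows "f summable_on UNIV"
proof -
  let ?s = "\<lambda>F. \<Sum>i\<in>F. (norm (f i))\<^sup>2" and ?S = "\<Sum>\<^sub>\<infinity>i. (norm (f i))\<^sup>2"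
  have lim: "(?s \<longlongrightarrow> ?S) (finite_subsets_at_top UNIV)"
    using has_sum_infsum[OF sm] by (simp add: has_sum_def)
  have "\<exists>P. eventually P (finite_subsets_at_top UNIV) \<and>
      (\<forall>F F'. P F \<and> P F' \<longrightarrow> dist (sum f F) (sum f F') < e)" if "e > 0" for e
  proof -
    have "\<forall>\<^sub>F F in finite_subsets_at_top UNIV. dist (?s F) ?S < (e / 2)\<^sup>2"
      by (rule tendstoD[OF lim]) (use \<open>e > 0\<close> in simp)
    then obtain F0 where F0: "finite F0" "dist (?s F0) ?S < (e / 2)\<^sup>2"
      by (auto simp: eventually_finite_subsets_at_top)
    have near: "dist (sum f F) (sum f F0) < e / 2" if F: "finite F" "F0 \<subseteq> F" for F
    proof -
      have "(dist (sum f F) (sum f F0))\<^sup>2 = (norm (sum f (F - F0)))\<^sup>2"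
        using F by (simp add: dist_norm sum_diff)
      also have "\<dots> = ?s (F - F0)"
        using F orth by (intro norm_sum_square_orthogonal) auto
      also have "\<dots> = ?s F - ?s F0" using F by (simp add: sum_diff)
      also have "\<dots> \<le> ?S - ?s F0"
        by (intro diff_right_mono finite_sum_le_infsum sm F) auto
      also have "\<dots> < (e / 2)\<^sup>2" using F0(2) by (simp add: dist_real_def)
      finally show ?thesis by (rule power_less_imp_less_base) (use \<open>e > 0\<close> in simp)
    qed
    show ?thesis
    proof (intro exI conjI allI impI)
      show "\<forall>\<^sub>F F in finite_subsets_at_top UNIV. finite F \<and> F0 \<subseteq> F"
        using F0(1) by (auto simp: eventually_finite_subsets_at_top)
      show "dist (sum f F) (sum f F') < e"
        if "(finite F \<and> F0 \<subseteq> F) \<and> finite F' \<and> F0 \<subseteq> F'" for F F'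
        using near[of F] near[of F'] that dist_triangle2[of "sum f F" "sum f F'" "sum f F0"]
        by linarith
    qed
  qed
  then have "cauchy_filter (filtermap (sum f) (finite_subsets_at_top UNIV))"
    by (simp add: cauchy_filter_metric_filtermap)
  moreover have "complete (UNIV :: 'a set)"
    by (meson Cauchy_convergent UNIV_I complete_def convergent_def)
  ultimately obtain L where "(sum f \<longlongrightarrow> L) (finite_subsets_at_top UNIV)"
    using complete_uniform[where S = "UNIV :: 'a set"] by (force simp: filterlim_def)
  then show ?thesis unfolding summable_on_def has_sum_def by blast
qed

lemma norm_infsum_orthogonal:
  fixes f :: "'i \<Rightarrow> 'a :: chilbert_space"
  assumes orth: "\<And>i j. i \<noteq> j \<Longrightarrow> cinner (f i) (f j) = 0"
    and sm: "(\<lambda>i. (norm (f i))\<^sup>2) summable_on UNIV"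
  shows "(norm (infsum f UNIV))\<^sup>2 = (\<Sum>\<^sub>\<infinity>i. (norm (f i))\<^sup>2)"
proof (rule tendsto_unique)
  have "(sum f \<longlongrightarrow> infsum f UNIV) (finite_subsets_at_top UNIV)"
    using has_sum_infsum[OF summable_on_orthogonal[OF assms]] by (simp add: has_sum_def)
  then have "((\<lambda>F. (norm (sum f F))\<^sup>2) \<longlongrightarrow> (norm (infsum f UNIV))\<^sup>2) (finite_subsets_at_top UNIV)"
    by (intro tendsto_intros)
  moreover have "\<forall>\<^sub>F F in finite_subsets_at_top UNIV.
      (norm (sum f F))\<^sup>2 = (\<Sum>i\<in>F. (norm (f i))\<^sup>2)"
    by (rule eventually_finite_subsets_at_top_weakI) (simp add: norm_sum_square_orthogonal orth)
  ultimately show "((\<lambda>F. \<Sum>i\<in>F. (norm (f i))\<^sup>2) \<longlongrightarrow> (norm (infsum f UNIV))\<^sup>2)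
      (finite_subsets_at_top UNIV)"
    by (rule Lim_transform_eventually)
  show "((\<lambda>F. \<Sum>i\<in>F. (norm (f i))\<^sup>2) \<longlongrightarrow> (\<Sum>\<^sub>\<infinity>i. (norm (f i))\<^sup>2)) (finite_subsets_at_top UNIV)"
    using has_sum_infsum[OF sm] by (simp add: has_sum_def)
qed simp

section \<open>Orthogonal projection onto a closed subspace\<close>

lemma csubspace_scaleR: "csubspace X \<Longrightarrow> x \<in> X \<Longrightarrow> r *\<^sub>R x \<in> X"
  using complex_vector.subspace_scale[of X x "complex_of_real r"] by (simp add: scaleC_of_real)

text \<open>Subtracting from \<open>z\<close> its component along \<open>y\<close> lowers the
  squared norm by |<z, y>|^2 / |y|^2, which minimality forces to be 0.\<close>

lemma cinner_eq_0_if_minimal: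
  fixes z :: "'a :: complex_inner"
  assumes "csubspace Y" "y \<in> Y" and min: "\<And>v. v \<in> Y \<Longrightarrow> norm z \<le> norm (z - v)"
  shows "cinner z y = 0"
proof (cases "y = 0")
  case False
  define c where "c = cinner z y / of_real ((norm y)\<^sup>2)"
  have "cinner z (c *\<^sub>C y) = of_real ((cmod (cinner z y))\<^sup>2 / (norm y)\<^sup>2)"
    by (simp add: cinner_scaleC_right c_def complex_norm_square[unfolded of_real_power])
  then have re: "Re (cinner z (c *\<^sub>C y)) = (cmod (cinner z y))\<^sup>2 / (norm y)\<^sup>2"
    by (metis Re_complex_of_real)
  have "norm (c *\<^sub>C y) = cmod (cinner z y) / norm y"
    using False by (simp add: norm_scaleC c_def norm_divide norm_mult power2_eq_square)
  then have nrm: "(norm (c *\<^sub>C y))\<^sup>2 = (cmod (cinner z y))\<^sup>2 / (norm y)\<^sup>2"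
    by (simp add: power_divide)
  have "(norm z)\<^sup>2 \<le> (norm (z - c *\<^sub>C y))\<^sup>2"
    using assms by (intro power_mono min complex_vector.subspace_scale) auto
  then have "(cmod (cinner z y))\<^sup>2 / (norm y)\<^sup>2 \<le> 0"
    by (simp add: norm_diff_square re nrm)
  then show ?thesis using False by (simp add: divide_le_0_iff)
qed simp

lemma orthogonal_decomposition:
  fixes x :: "'a :: chilbert_space"
  assumes Y: "csubspace Y" "closed Y"
  obtains y z where "y \<in> Y" "x = y + z" "\<And>v. v \<in> Y \<Longrightarrow> cinner z v = 0"
proof -
  define \<delta> where "\<delta> = Inf ((\<lambda>v. norm (x - v)) ` Y)"
  have ne: "Y \<noteq> {}" using Y(1) complex_vector.subspace_0 by blast
  have bdd: "bdd_below ((\<lambda>v. norm (x - v)) ` Y)" by (rule bdd_belowI2[of _ 0]) simp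
  have lower: "\<delta> \<le> norm (x - v)" if "v \<in> Y" for v
    unfolding \<delta>_def by (rule cINF_lower[OF bdd that])
  have \<delta>: "0 \<le> \<delta>" unfolding \<delta>_def using ne by (intro cINF_greatest) auto
  have "\<exists>v\<in>Y. norm (x - v) < \<delta> + inverse (of_nat (Suc m))" for m
    using cINF_less_iff[OF ne bdd, of "\<delta> + inverse (of_nat (Suc m))"]
    by (simp add: \<delta>_def[symmetric])
  then obtain v where v: "v m \<in> Y" "norm (x - v m) < \<delta> + inverse (of_nat (Suc m))" for m
    by metis
  have lim: "(\<lambda>m. norm (x - v m)) \<longlonglongrightarrow> \<delta>"
  proof (rule tendsto_sandwich)
    show "\<forall>\<^sub>F m in sequentially. \<delta> \<le> norm (x - v m)" by (simp add: lower v)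
    show "\<forall>\<^sub>F m in sequentially. norm (x - v m) \<le> \<delta> + inverse (of_nat (Suc m))"
      using v(2) by (intro always_eventually allI less_imp_le)
    show "(\<lambda>m. \<delta> + inverse (real (Suc m))) \<longlonglongrightarrow> \<delta>"
      using tendsto_add[OF tendsto_const LIMSEQ_inverse_real_of_nat, of \<delta>] by simp
  qed simp
  \<comment> \<open>The parallelogram law for \<open>x - v m\<close> and \<open>x - v k\<close>.
    Their mean is \<open>x\<close> minus the midpoint of \<open>v m\<close> and \<open>v k\<close>,
    which lies in \<open>Y\<close>, so its norm is at least \<delta>.\<close>
  have par: "(norm (v m - v k))\<^sup>2
      \<le> 2 * (norm (x - v m))\<^sup>2 + 2 * (norm (x - v k))\<^sup>2 - 4 * \<delta>\<^sup>2" for m k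
  proof -
    let ?a = "x - v m" and ?b = "x - v k"
    have "(1/2) *\<^sub>R (v m + v k) \<in> Y"
      using Y(1) v(1) by (intro csubspace_scaleR complex_vector.subspace_add)
    then have "\<delta> \<le> norm (x - (1/2) *\<^sub>R (v m + v k))" by (rule lower)
    also have "x - (1/2) *\<^sub>R (v m + v k) = (1/2) *\<^sub>R (?a + ?b)"
      by (simp add: algebra_simps flip: scaleR_left_distrib)
    finally have "2 * \<delta> \<le> norm (?a + ?b)" by simp
    then have "(2 * \<delta>)\<^sup>2 \<le> (norm (?a + ?b))\<^sup>2" using \<delta> by (intro power_mono) auto
    moreover have "norm (v m - v k) = norm (?a - ?b)" by (simp add: norm_minus_commute)
    ultimately show ?thesis
      by (simp only: norm_diff_square[of ?a ?b] norm_add_square power_mult_distrib) simp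
  qed
  have "Cauchy v"
  proof (rule metric_CauchyI)
    fix e :: real assume "e > 0"
    have "(\<lambda>m. (norm (x - v m))\<^sup>2) \<longlonglongrightarrow> \<delta>\<^sup>2" by (intro tendsto_intros lim)
    \<comment> \<open>Both deviations enter \<open>par\<close> with factor 2 and the terms in
      \<delta> cancel, so two errors below a quarter of the squared \<open>e\<close>
      suffice.\<close>
    from LIMSEQ_D[OF this, of "e\<^sup>2 / 4"] \<open>e > 0\<close>
    obtain N where N: "\<And>m. m \<ge> N \<Longrightarrow> \<bar>(norm (x - v m))\<^sup>2 - \<delta>\<^sup>2\<bar> < e\<^sup>2 / 4" by auto
    have "dist (v m) (v k) < e" if "m \<ge> N" "k \<ge> N" for m k
    proof (rule power_less_imp_less_base)
      show "(dist (v m) (v k))\<^sup>2 < e\<^sup>2"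
        using par[of m k] N[OF that(1)] N[OF that(2)] unfolding dist_norm by linarith
    qed (use \<open>e > 0\<close> in simp)
    then show "\<exists>N. \<forall>m\<ge>N. \<forall>k\<ge>N. dist (v m) (v k) < e" by blast
  qed
  then obtain y where y: "v \<longlonglongrightarrow> y" using Cauchy_convergent convergent_def by blast
  have yY: "y \<in> Y" using closed_sequentially[OF Y(2)] v(1) y by blast
  have "(\<lambda>m. norm (x - v m)) \<longlonglongrightarrow> norm (x - y)" by (intro tendsto_intros y)
  with lim have ny: "norm (x - y) = \<delta>" by (rule LIMSEQ_unique[symmetric])
  have "cinner (x - y) u = 0" if "u \<in> Y" for u
  proof (rule cinner_eq_0_if_minimal[OF Y(1) that])
    show "norm (x - y) \<le> norm (x - y - w)" if "w \<in> Y" for w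
      unfolding ny using lower[OF complex_vector.subspace_add[OF Y(1) yY that]]
      by (simp add: diff_diff_eq)
  qed
  with yY show ?thesis by (intro that[of y "x - y"]) auto
qed

section \<open>Bounded complex-linear maps, and isometries on a subspace\<close>

lemma bounded_clinearD:
  assumes "bounded_clinear T"
  shows "bounded_linear T" and "T (x + y) = T x + T y" and "T (x - y) = T x - T y"
    and "T 0 = 0" and "T (c *\<^sub>C x) = c *\<^sub>C T x" and "T (r *\<^sub>R x) = r *\<^sub>R T x"
proof -
  show b: "bounded_linear T" and "T (c *\<^sub>C x) = c *\<^sub>C T x"
    using assms by (auto simp: bounded_clinear_def)
  from b interpret bounded_linear T .
  show "T (x + y) = T x + T y" "T (x - y) = T x - T y" "T 0 = 0" "T (r *\<^sub>R x) = r *\<^sub>R T x"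
    by (fact add diff zero scaleR)+
qed

lemma bounded_clinearI:
  assumes "\<And>x y. T (x + y) = T x + T y" "\<And>c x. T (c *\<^sub>C x) = c *\<^sub>C T x"
    and "\<And>x. norm (T x) \<le> B * norm x"
  shows "bounded_clinear T"
  unfolding bounded_clinear_def
proof (intro conjI allI)
  show "bounded_linear T"
    by (rule bounded_linear_intro[where K = B])
      (use assms in \<open>simp_all add: mult.commute scaleC_of_real[symmetric]\<close>)
qed (rule assms(2))

lemma bounded_clinear_scaleC: "bounded_clinear (\<lambda>x :: 'a :: complex_inner. c *\<^sub>C x)"
  by (rule bounded_clinearI[where B = "cmod c"])
    (simp_all add: scaleC_add_right scaleC_scaleC mult.commute norm_scaleC)

lemma csubspace_vimage:
  assumes "bounded_clinear T" "csubspace X"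
  shows "csubspace (T -` X)"
  unfolding complex_vector.subspace_def
  using assms by (simp add: bounded_clinearD complex_vector.subspace_0
      complex_vector.subspace_add complex_vector.subspace_scale)

lemma closed_vimage_clinear:
  assumes "bounded_clinear T" "closed X"
  shows "closed (T -` X)"
  by (intro closed_vimage assms(2) linear_continuous_on bounded_clinearD(1) assms(1)
      continuous_at_imp_continuous_on ballI linear_continuous_at)

lemma csubspace_diff: "csubspace X \<Longrightarrow> x \<in> X \<Longrightarrow> y \<in> X \<Longrightarrow> x - y \<in> X"
  using complex_vector.subspace_diff by blast

text \<open>Polarization: norms of sums determine real parts, and the real part against
  \<open>\<i> *\<^sub>C y\<close> is the imaginary part against \<open>y\<close>. Linearity is
  assumed on \<open>X\<close> only, because \<open>wold\<close> is linear only where its series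
  converges.\<close>

lemma cinner_eq_if_norm_eq:
  fixes f :: "'a :: complex_inner \<Rightarrow> 'b :: complex_inner"
  assumes X: "csubspace X" "x \<in> X" "y \<in> X"
    and add: "\<And>x y. x \<in> X \<Longrightarrow> y \<in> X \<Longrightarrow> f (x + y) = f x + f y"
    and scale: "\<And>c x. x \<in> X \<Longrightarrow> f (c *\<^sub>C x) = c *\<^sub>C f x"
    and nrm: "\<And>x. x \<in> X \<Longrightarrow> norm (f x) = norm x"
  shows "cinner (f x) (f y) = cinner x y"
proof -
  have re: "Re (cinner (f u) (f v)) = Re (cinner u v)" if "u \<in> X" "v \<in> X" for u v
    using norm_add_square[of u v] norm_add_square[of "f u" "f v"] that
    by (simp add: nrm complex_vector.subspace_add[OF X(1)] flip: add)
  have iy: "\<i> *\<^sub>C y \<in> X" using X by (intro complex_vector.subspace_scale)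
  have "Im (cinner (f x) (f y)) = Im (cinner x y)"
    using re[OF X(2) iy] by (simp add: scale X cinner_scaleC_right)
  with re[OF X(2,3)] show ?thesis by (rule complex_eqI)
qed

text \<open>A convergent sequence in the image is Cauchy, hence so is the sequence of its preimages;
  the limit of the latter lies in \<open>X\<close> and is mapped to the limit of the former.\<close>

lemma closed_isometric_image:
  fixes f :: "'a :: chilbert_space \<Rightarrow> 'b :: chilbert_space"
  assumes X: "csubspace X" "closed X"
    and diff: "\<And>x y. x \<in> X \<Longrightarrow> y \<in> X \<Longrightarrow> f (x - y) = f x - f y"
    and nrm: "\<And>x. x \<in> X \<Longrightarrow> norm (f x) = norm x"
  shows "closed (f ` X)"
  unfolding closed_sequential_limits
proof (intro allI impI, elim conjE)
  fix z l assume z: "\<forall>n. z n \<in> f ` X" and zl: "z \<longlonglongrightarrow> l"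
  then obtain x where x: "x n \<in> X" "z n = f (x n)" for n
    unfolding image_iff by metis
  have iso: "dist (f u) (f v) = dist u v" if "u \<in> X" "v \<in> X" for u v
    using that X(1) by (simp add: dist_norm csubspace_diff nrm flip: diff)
  have "Cauchy z" using zl by (rule LIMSEQ_imp_Cauchy)
  then have "Cauchy x" by (simp add: Cauchy_def x(2) iso[OF x(1) x(1)])
  then obtain a where a: "x \<longlonglongrightarrow> a" using Cauchy_convergent convergent_def by blast
  have aX: "a \<in> X" using closed_sequentially[OF X(2)] x(1) a by blast
  have "(\<lambda>n. dist (x n) a) \<longlonglongrightarrow> 0" using a by (rule tendsto_dist_iff[THEN iffD1])
  then have "(\<lambda>n. dist (z n) (f a)) \<longlonglongrightarrow> 0" by (simp add: x(2) iso[OF x(1) aX])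
  then have "z \<longlonglongrightarrow> f a" by (rule tendsto_dist_iff[THEN iffD2])
  then have "l = f a" using zl LIMSEQ_unique by blast
  then show "l \<in> f ` X" using aX by blast
qed

section \<open>Coordinate maps and the subspaces \<open>fock_tensor D\<close>\<close>

lemma bounded_clinear_ell2_nth: "bounded_clinear (\<lambda>x. ell2_nth x i)"
  by (rule bounded_clinearI[where B = 1])
    (simp_all add: plus_ell2.rep_eq scaleC_ell2.rep_eq norm_ell2_nth_le)

lemma fock_tensor_eq: "fock_tensor D = (\<Inter>\<alpha>. (\<lambda>\<phi>. ell2_nth \<phi> \<alpha>) -` D)"
  by (auto simp: fock_tensor_def)

lemma csubspace_fock_tensor: "csubspace D \<Longrightarrow> csubspace (fock_tensor D)"
  unfolding fock_tensor_eq
  by (rule complex_vector.subspace_Inter) (auto intro: csubspace_vimage[OF bounded_clinear_ell2_nth])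

lemma closed_fock_tensor: "closed D \<Longrightarrow> closed (fock_tensor D)"
  unfolding fock_tensor_eq
  by (rule closed_Inter) (auto intro: closed_vimage_clinear[OF bounded_clinear_ell2_nth])

lemma tensor_id_left_creation_in_fock_tensor:
  assumes "csubspace D" "\<phi> \<in> fock_tensor D"
  shows "tensor_id (left_creation i) \<phi> \<in> fock_tensor D"
  using assms complex_vector.subspace_0[OF assms(1)]
  by (auto simp: fock_tensor_def tensor_id_left_creation split: list.split)

lemma nth_basis_otimes: "ell2_nth (fock_basis \<alpha> \<otimes>\<^sub>F k) \<beta> = (if \<beta> = \<alpha> then k else 0)"
  by (simp add: otimes.rep_eq fock_basis.rep_eq)

section \<open>The Wold decomposition\<close>

text \<open>The maps \<open>A i\<close> stand for the adjoints of the \<open>V i\<close>;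
  \<open>A_V\<close> is enough for \<open>x = (\<Sum>i\<in>UNIV. V i (A i x))\<close> to single out
  the vectors in the sum of the ranges. Purity is stated coinductively, for a set \<open>Z\<close>
  that is stable under taking components, so that it can be applied directly to an orthogonal
  complement.\<close>

locale pure_row_isometry =
  fixes V A :: "'n :: finite \<Rightarrow> 'h :: chilbert_space \<Rightarrow> 'h"
  assumes clinear_V: "bounded_clinear (V i)"
    and clinear_A: "bounded_clinear (A i)"
    and A_V: "A j (V i x) = (if j = i then x else 0)"
    and cinner_V: "cinner (V i x) (V j y) = (if i = j then cinner x y else 0)"
    and pure: \<comment> \<open>no nonzero vector lies in $\sum_{|\alpha| = k} V_\alpha H$ for all $k$\<close>
      "(\<And>x. x \<in> Z \<Longrightarrow> x = (\<Sum>i\<in>UNIV. V i (A i x)) \<and> (\<forall>i. A i x \<in> Z)) \<Longrightarrow> Z \<subseteq> {0}"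
begin

lemma clinear_word: "bounded_clinear (word_op V \<alpha>)"
proof (induction \<alpha>)
  case Nil
  then show ?case by (simp add: bounded_clinear_def id_def bounded_linear_ident)
next
  case (Cons i \<alpha>)
  then show ?case
    using clinear_V[of i] bounded_linear_compose[of "V i" "word_op V \<alpha>"]
    by (auto simp: bounded_clinear_def o_def)
qed

lemma cinner_word: "cinner (word_op V \<alpha> x) (word_op V \<alpha> y) = cinner x y"
  by (induction \<alpha>) (simp_all add: cinner_V)

lemma norm_word: "norm (word_op V \<alpha> x) = norm x"
proof -
  have "complex_of_real ((norm (word_op V \<alpha> x))\<^sup>2) = complex_of_real ((norm x)\<^sup>2)"
    unfolding norm_square_eq_cinner by (rule cinner_word)
  then show ?thesis by (simp only: of_real_eq_iff power2_eq_iff_nonneg norm_ge_zero)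
qed

end

text \<open>
  The unitary \<open>R\<close> places the multiplicity space of the Wold decomposition in a prescribed copy
  \<open>'d\<close> of \<open>'h\<close>.
\<close>

locale invariant_subspace = pure_row_isometry V A
  for V A :: "'n :: finite \<Rightarrow> 'h :: chilbert_space \<Rightarrow> 'h" +
  fixes N :: "'h set" and R :: "'d :: chilbert_space \<Rightarrow> 'h"
  assumes N: "csubspace N" "closed N"
    and V_N: "x \<in> N \<Longrightarrow> V i x \<in> N"
    and R: "bounded_clinear R" "norm (R k) = norm k" "surj R"
begin

definition "L = {l\<in>N. \<forall>i. \<forall>y\<in>N. cinner l (V i y) = 0}"

definition "D = R -` L"

text \<open>An \<open>infsum\<close> without convergence is 0, so the formula is meaningful only on
  \<open>fock_tensor D\<close>, where the summands are orthogonal; therefore the facts on linearity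
  and norms are restricted to that subspace.\<close>

definition wold :: "('n, 'd) fock \<Rightarrow> 'h"
  where "wold \<phi> = (\<Sum>\<^sub>\<infinity>\<alpha>. word_op V \<alpha> (R (ell2_nth \<phi> \<alpha>)))"

lemma word_N: "x \<in> N \<Longrightarrow> word_op V \<alpha> x \<in> N"
  by (induction \<alpha>) (simp_all add: V_N)

lemma L_eq: "L = N \<inter> (\<Inter>i. \<Inter>y\<in>N. (\<lambda>l. cinner l (V i y)) -` {0})"
  by (auto simp: L_def)

lemma csubspace_D: "csubspace D"
  unfolding D_def
proof (rule csubspace_vimage[OF R(1)])
  show "csubspace L"
    using N(1) unfolding L_def complex_vector.subspace_def
    by (simp add: cinner_add_left cinner_scaleC_left)
qed

lemma closed_D: "closed D"
  unfolding D_def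
proof (rule closed_vimage_clinear[OF R(1)])
  show "closed L"
    unfolding L_eq
    by (intro closed_Int closed_INT ballI N closed_vimage closed_singleton
        continuous_at_imp_continuous_on linear_continuous_at bounded_linear_cinner_left)
qed

lemma orthogonal_word_L:
  assumes "l \<in> L" "l' \<in> L" "\<alpha> \<noteq> \<beta>"
  shows "cinner (word_op V \<alpha> l) (word_op V \<beta> l') = 0"
  using \<open>\<alpha> \<noteq> \<beta>\<close>
proof (induction \<alpha> arbitrary: \<beta>)
  case Nil
  then show ?case using assms word_N by (cases \<beta>) (auto simp: L_def)
next
  case (Cons i \<alpha>)
  show ?case
  proof (cases \<beta>)
    case Nil
    then have "cinner (word_op V \<beta> l') (word_op V (i # \<alpha>) l) = 0"
      using assms word_N by (auto simp: L_def)
    then show ?thesis by (subst cinner_eq_0_commute)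
  next
    case (Cons j \<beta>')
    then show ?thesis using Cons.IH Cons.prems by (auto simp: cinner_V)
  qed
qed

lemma
  assumes "\<phi> \<in> fock_tensor D"
  shows summable_wold: "(\<lambda>\<alpha>. word_op V \<alpha> (R (ell2_nth \<phi> \<alpha>))) summable_on UNIV"
    and norm_wold: "norm (wold \<phi>) = norm \<phi>"
proof -
  let ?f = "\<lambda>\<alpha>. word_op V \<alpha> (R (ell2_nth \<phi> \<alpha>))"
  have orth: "cinner (?f \<alpha>) (?f \<beta>) = 0" if "\<alpha> \<noteq> \<beta>" for \<alpha> \<beta>
    using assms that by (intro orthogonal_word_L) (auto simp: fock_tensor_def D_def)
  have nrm: "norm (?f \<alpha>) = norm (ell2_nth \<phi> \<alpha>)" for \<alpha> by (simp add: norm_word R(2))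
  have sm: "(\<lambda>\<alpha>. (norm (?f \<alpha>))\<^sup>2) summable_on UNIV"
    using ell2_nth[of \<phi>] by (simp add: nrm)
  show "?f summable_on UNIV" by (rule summable_on_orthogonal[OF orth sm])
  have "(norm (wold \<phi>))\<^sup>2 = (\<Sum>\<^sub>\<infinity>\<alpha>. (norm (?f \<alpha>))\<^sup>2)"
    unfolding wold_def by (rule norm_infsum_orthogonal[OF orth sm])
  also have "\<dots> = (norm \<phi>)\<^sup>2"
    by (simp add: nrm norm_ell2.rep_eq infsum_nonneg)
  finally show "norm (wold \<phi>) = norm \<phi>" by (simp add: power2_eq_iff_nonneg)
qed

lemma wold_add:
  assumes "\<phi> \<in> fock_tensor D" "\<psi> \<in> fock_tensor D"
  shows "wold (\<phi> + \<psi>) = wold \<phi> + wold \<psi>"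
  unfolding wold_def
  by (subst infsum_add[symmetric])
    (simp_all add: summable_wold assms plus_ell2.rep_eq bounded_clinearD[OF R(1)]
      bounded_clinearD[OF clinear_word])

lemma wold_scaleC:
  assumes "\<phi> \<in> fock_tensor D"
  shows "wold (c *\<^sub>C \<phi>) = c *\<^sub>C wold \<phi>"
proof -
  have "((\<lambda>\<alpha>. c *\<^sub>C word_op V \<alpha> (R (ell2_nth \<phi> \<alpha>))) has_sum c *\<^sub>C wold \<phi>) UNIV"
    using has_sum_bounded_linear[OF bounded_clinearD(1)[OF bounded_clinear_scaleC]
        has_sum_infsum[OF summable_wold[OF assms]]]
    by (simp add: o_def wold_def)
  then show ?thesis
    by (simp add: wold_def scaleC_ell2.rep_eq bounded_clinearD[OF R(1)]
      bounded_clinearD[OF clinear_word] infsumI)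
qed

lemma wold_diff:
  assumes "\<phi> \<in> fock_tensor D" "\<psi> \<in> fock_tensor D"
  shows "wold (\<phi> - \<psi>) = wold \<phi> - wold \<psi>"
proof -
  have "\<phi> - \<psi> \<in> fock_tensor D"
    using assms by (intro csubspace_diff csubspace_fock_tensor csubspace_D)
  from wold_add[OF this assms(2)] show ?thesis by simp
qed

lemma cinner_wold:
  assumes "\<phi> \<in> fock_tensor D" "\<psi> \<in> fock_tensor D"
  shows "cinner (wold \<phi>) (wold \<psi>) = cinner \<phi> \<psi>"
  by (rule cinner_eq_if_norm_eq[OF csubspace_fock_tensor[OF csubspace_D] assms])
    (simp_all add: wold_add wold_scaleC norm_wold)

lemma wold_left_creation:
  assumes "\<phi> \<in> fock_tensor D"
  shows "wold (tensor_id (left_creation i) \<phi>) = V i (wold \<phi>)"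
proof -
  let ?g = "\<lambda>\<beta>. word_op V \<beta> (R (ell2_nth (tensor_id (left_creation i) \<phi>) \<beta>))"
  have "((\<lambda>\<alpha>. V i (word_op V \<alpha> (R (ell2_nth \<phi> \<alpha>)))) has_sum V i (wold \<phi>)) UNIV"
    using has_sum_bounded_linear[OF bounded_clinearD(1)[OF clinear_V[of i]]
        has_sum_infsum[OF summable_wold[OF assms]]]
    by (simp add: o_def wold_def)
  then have "(?g \<circ> (#) i has_sum V i (wold \<phi>)) UNIV"
    by (simp add: o_def tensor_id_left_creation)
  then have "(?g has_sum V i (wold \<phi>)) (range ((#) i))"
    by (subst has_sum_reindex) auto
  \<comment> \<open>Words outside \<open>range ((#) i)\<close> carry coefficient 0 in the shifted
    family.\<close>
  then have "(?g has_sum V i (wold \<phi>)) UNIV"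
    by (rule has_sum_cong_neutral[THEN iffD1, rotated -1])
      (auto simp: tensor_id_left_creation bounded_clinearD[OF R(1)]
        bounded_clinearD[OF clinear_word] bounded_clinearD[OF clinear_V] split: list.splits)
  then show ?thesis unfolding wold_def by (rule infsumI)
qed

lemma wold_basis: "wold (fock_basis \<alpha> \<otimes>\<^sub>F k) = word_op V \<alpha> (R k)"
proof -
  let ?f = "\<lambda>\<beta>. word_op V \<beta> (R (ell2_nth (fock_basis \<alpha> \<otimes>\<^sub>F k) \<beta>))"
  have "(?f has_sum word_op V \<alpha> (R k)) {\<alpha>}"
    using has_sum_finite[of "{\<alpha>}" ?f]
    by (simp add: nth_basis_otimes)
  then have "(?f has_sum word_op V \<alpha> (R k)) UNIV"
    by (rule has_sum_cong_neutral[THEN iffD1, rotated -1])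
      (auto simp: nth_basis_otimes bounded_clinearD[OF R(1)] bounded_clinearD[OF clinear_word])
  then show ?thesis unfolding wold_def by (rule infsumI)
qed

lemma wold_in_N:
  assumes "\<phi> \<in> fock_tensor D"
  shows "wold \<phi> \<in> N"
proof (rule Lim_in_closed_set[OF N(2)])
  show "(sum (\<lambda>\<alpha>. word_op V \<alpha> (R (ell2_nth \<phi> \<alpha>))) \<longlongrightarrow> wold \<phi>) (finite_subsets_at_top UNIV)"
    using has_sum_infsum[OF summable_wold[OF assms]] by (simp add: has_sum_def wold_def)
  have "word_op V \<alpha> (R (ell2_nth \<phi> \<alpha>)) \<in> N" for \<alpha>
    using assms by (intro word_N) (auto simp: fock_tensor_def D_def L_def)
  then show "\<forall>\<^sub>F F in finite_subsets_at_top UNIV. (\<Sum>\<alpha>\<in>F. word_op V \<alpha> (R (ell2_nth \<phi> \<alpha>))) \<in> N"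
    by (intro always_eventually allI complex_vector.subspace_sum[OF N(1)])
qed simp

lemma orthogonal_L_imp:
  assumes x: "x \<in> N" and orth: "\<And>l. l \<in> L \<Longrightarrow> cinner x l = 0"
  shows "x = (\<Sum>i\<in>UNIV. V i (A i x))" and "A i x \<in> N"
proof -
  define Y where "Y = {y. y = (\<Sum>i\<in>UNIV. V i (A i y)) \<and> (\<forall>i. A i y \<in> N)}"
  note simps = bounded_clinearD[OF clinear_V] bounded_clinearD[OF clinear_A]
  have lin: "bounded_clinear (\<lambda>y. y - (\<Sum>i\<in>UNIV. V i (A i y)))"
    unfolding bounded_clinear_def
    by (auto intro!: bounded_linear_sub bounded_linear_ident bounded_linear_sum
      bounded_linear_compose[OF bounded_clinearD(1)[OF clinear_V]] bounded_clinearD(1)[OF clinear_A]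
      simp: simps complex_vector.scale_right_diff_distrib complex_vector.scale_sum_right)
  have Y_eq: "Y = (\<lambda>y. y - (\<Sum>i\<in>UNIV. V i (A i y))) -` {0} \<inter> (\<Inter>i. A i -` N)"
    by (auto simp: Y_def)
  have sY: "csubspace Y"
    unfolding Y_eq
    by (intro complex_vector.subspace_inter complex_vector.subspace_Inter)
      (auto intro!: csubspace_vimage lin clinear_A N)
  have cY: "closed Y"
    unfolding Y_eq
    by (intro closed_Int closed_INT ballI closed_vimage_clinear lin clinear_A N closed_singleton)
  obtain y z where yz: "y \<in> Y" "x = y + z" "\<And>v. v \<in> Y \<Longrightarrow> cinner z v = 0"
    using orthogonal_decomposition[OF sY cY, of x] by blast
  have "(\<Sum>i\<in>UNIV. V i (A i y)) \<in> N"
    using yz(1) by (intro complex_vector.subspace_sum[OF N(1)] V_N) (auto simp: Y_def)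
  then have "y \<in> N" using yz(1) by (simp add: Y_def)
  then have "z \<in> N" using x yz(2) csubspace_diff[OF N(1), of x y] by simp
  moreover have "V i v \<in> Y" if "v \<in> N" for i v
  proof -
    have "(\<Sum>j\<in>UNIV. V j (A j (V i v))) = (\<Sum>j\<in>UNIV. if j = i then V i v else 0)"
      by (rule sum.cong) (auto simp: A_V simps)
    also have "\<dots> = V i v" by simp
    finally show ?thesis
      unfolding Y_def using that N(1) by (simp add: A_V complex_vector.subspace_0)
  qed
  ultimately have "z \<in> L" unfolding L_def using yz(3) by blast
  then have "cinner (y + z) z = 0" using orth yz(2) by blast
  moreover have "cinner y z = 0" using yz(1,3) cinner_eq_0_commute by blast
  ultimately have "z = 0" by (simp add: cinner_add_left)
  then have "x \<in> Y" using yz by simp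
  then show "x = (\<Sum>i\<in>UNIV. V i (A i x))" and "A i x \<in> N" unfolding Y_def by blast+
qed

lemma wold_onto: "wold ` fock_tensor D = N"
proof
  show "wold ` fock_tensor D \<subseteq> N" using wold_in_N by blast
  note sD = csubspace_fock_tensor[OF csubspace_D]
  have sub: "csubspace (wold ` fock_tensor D)"
    unfolding complex_vector.subspace_def
  proof (intro conjI ballI allI)
    have "0 - 0 \<in> fock_tensor D" using complex_vector.subspace_0[OF sD] by simp
    then show "0 \<in> wold ` fock_tensor D"
      using wold_diff[of 0 0] complex_vector.subspace_0[OF sD] by (force simp: image_iff)
    show "x + y \<in> wold ` fock_tensor D"
      if "x \<in> wold ` fock_tensor D" "y \<in> wold ` fock_tensor D" for x y
      using that complex_vector.subspace_add[OF sD] by (auto intro!: imageI simp flip: wold_add)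
    show "c *\<^sub>C x \<in> wold ` fock_tensor D" if "x \<in> wold ` fock_tensor D" for c x
      using that complex_vector.subspace_scale[OF sD] by (auto intro!: imageI simp flip: wold_scaleC)
  qed
  have cl: "closed (wold ` fock_tensor D)"
    by (intro closed_isometric_image sD closed_fock_tensor closed_D wold_diff norm_wold)
  \<comment> \<open>The part of \<open>N\<close> orthogonal to the range of \<open>wold\<close>. Its
    elements are orthogonal to \<open>L\<close> by the empty word, and their components inherit the
    remaining conditions from words with one more letter, so purity applies.\<close>
  define Z where "Z = {z\<in>N. \<forall>\<alpha>. \<forall>l\<in>L. cinner z (word_op V \<alpha> l) = 0}"
  have "Z \<subseteq> {0}"
  proof (rule pure)
    fix x assume x: "x \<in> Z"
    have "cinner x l = 0" if "l \<in> L" for l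
    proof -
      have "cinner x (word_op V [] l) = 0" using x that unfolding Z_def by blast
      then show ?thesis by simp
    qed
    moreover have "x \<in> N" using x by (simp add: Z_def)
    ultimately have eq: "x = (\<Sum>i\<in>UNIV. V i (A i x))" and AN: "A i x \<in> N" for i
      using orthogonal_L_imp by blast+
    have "cinner (A i x) (word_op V \<alpha> l) = 0" if "l \<in> L" for i \<alpha> l
    proof -
      have "cinner x (word_op V (i # \<alpha>) l) = 0" using x that unfolding Z_def by blast
      also have "cinner x (word_op V (i # \<alpha>) l)
          = (\<Sum>j\<in>UNIV. cinner (V j (A j x)) (V i (word_op V \<alpha> l)))"
        by (subst eq) (simp add: cinner_sum_left)
      also have "\<dots> = cinner (A i x) (word_op V \<alpha> l)"
        by (simp add: cinner_V if_distrib cong: if_cong)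
      finally show ?thesis .
    qed
    then show "x = (\<Sum>i\<in>UNIV. V i (A i x)) \<and> (\<forall>i. A i x \<in> Z)"
      using eq AN unfolding Z_def by blast
  qed
  show "N \<subseteq> wold ` fock_tensor D"
  proof
    fix x assume x: "x \<in> N"
    obtain y z where yz: "y \<in> wold ` fock_tensor D" "x = y + z"
      "\<And>v. v \<in> wold ` fock_tensor D \<Longrightarrow> cinner z v = 0"
      using orthogonal_decomposition[OF sub cl, of x] by blast
    have "y \<in> N" using yz(1) wold_in_N by blast
    then have zN: "z \<in> N" using x yz(2) csubspace_diff[OF N(1), of x y] by simp
    have "cinner z (word_op V \<alpha> l) = 0" if l: "l \<in> L" for \<alpha> l
    proof (rule yz(3))
      \<comment> \<open>Surjectivity of \<open>R\<close> ensures that every wandering vector has a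
        copy in \<open>D\<close>.\<close>
      obtain k where k: "l = R k" using R(3) by (metis surjD)
      have "fock_basis \<alpha> \<otimes>\<^sub>F k \<in> fock_tensor D"
        using l k complex_vector.subspace_0[OF csubspace_D]
        by (simp add: fock_tensor_def nth_basis_otimes D_def)
      then show "word_op V \<alpha> l \<in> wold ` fock_tensor D"
        unfolding k by (rule image_eqI[rotated]) (simp add: wold_basis)
    qed
    then have "z \<in> Z" using zN by (simp add: Z_def)
    then have "z = 0" using \<open>Z \<subseteq> {0}\<close> by blast
    then show "x \<in> wold ` fock_tensor D" using yz by simp
  qed
qed

end

section \<open>Reindexing square-summable families\<close>

lemma ell2_nth_Abs_ell2:
  fixes f :: "'i \<Rightarrow> 'a :: chilbert_space"
  assumes "\<And>F. finite F \<Longrightarrow> L2_set (\<lambda>i. norm (f i)) F \<le> B"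
  shows "ell2_nth (Abs_ell2 f) = f" and "norm (Abs_ell2 f) \<le> B"
proof -
  show e: "ell2_nth (Abs_ell2 f) = f"
    by (rule Abs_ell2_inverse) (use L2_set_bounded_ell2(1)[OF assms] in blast)
  show "norm (Abs_ell2 f) \<le> B"
    unfolding norm_ell2.rep_eq e by (rule L2_set_bounded_ell2(2)[OF assms])
qed

definition pull :: "('i \<Rightarrow> 'j) \<Rightarrow> ('j, 'a :: chilbert_space) ell2 \<Rightarrow> ('i, 'a) ell2"
  where "pull h x = Abs_ell2 (\<lambda>i. ell2_nth x (h i))"

text \<open>For injective \<open>h\<close> this is the isometry that moves coordinate
  \<open>i\<close> to place \<open>h i\<close>; \<open>pull h\<close> is its adjoint.\<close>

definition push :: "('i \<Rightarrow> 'j) \<Rightarrow> ('i, 'a :: chilbert_space) ell2 \<Rightarrow> ('j, 'a) ell2"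
  where "push h x = Abs_ell2 (\<lambda>j. if j \<in> range h then ell2_nth x (inv h j) else 0)"

lemma
  assumes h: "inj h"
  shows ell2_nth_pull: "ell2_nth (pull h x) i = ell2_nth x (h i)"
    and norm_pull_le: "norm (pull h x) \<le> norm x"
proof -
  have "L2_set (\<lambda>i. norm (ell2_nth x (h i))) F \<le> norm x" if F: "finite F" for F
  proof -
    have "L2_set (\<lambda>i. norm (ell2_nth x (h i))) F = L2_set (\<lambda>j. norm (ell2_nth x j)) (h ` F)"
      unfolding L2_set_def using h by (simp add: sum.reindex inj_on_subset)
    also have "\<dots> \<le> norm x" using F by (intro L2_set_le_norm_ell2) simp
    finally show ?thesis .
  qed
  note * = ell2_nth_Abs_ell2[OF this]
  show "ell2_nth (pull h x) i = ell2_nth x (h i)" and "norm (pull h x) \<le> norm x"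
    unfolding pull_def by (simp_all add: *)
qed

lemma
  assumes h: "inj h"
  shows ell2_nth_push:
      "ell2_nth (push h x) = (\<lambda>j. if j \<in> range h then ell2_nth x (inv h j) else 0)"
    and norm_push_le: "norm (push h x) \<le> norm x"
proof -
  let ?f = "\<lambda>j. if j \<in> range h then ell2_nth x (inv h j) else 0"
  have "L2_set (\<lambda>j. norm (?f j)) F \<le> norm x" if F: "finite F" for F
  proof -
    have "L2_set (\<lambda>j. norm (?f j)) F = L2_set (\<lambda>j. norm (?f j)) (h ` (h -` F))"
      unfolding L2_set_def
      by (rule arg_cong[where f = sqrt], rule sum.mono_neutral_right) (use F in auto)
    also have "\<dots> = L2_set (\<lambda>i. norm (ell2_nth x i)) (h -` F)"
      unfolding L2_set_def by (subst sum.reindex) (use h in \<open>auto intro: inj_on_subset\<close>)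
    also have "\<dots> \<le> norm x" using F h by (intro L2_set_le_norm_ell2 finite_vimageI)
    finally show ?thesis .
  qed
  note * = ell2_nth_Abs_ell2[OF this]
  show "ell2_nth (push h x) = ?f" and "norm (push h x) \<le> norm x"
    unfolding push_def by (simp_all add: *)
qed

lemma bounded_clinear_pull: "inj h \<Longrightarrow> bounded_clinear (pull h)"
  by (rule bounded_clinearI[where B = 1])
    (simp_all add: ell2_eqI ell2_nth_pull plus_ell2.rep_eq scaleC_ell2.rep_eq norm_pull_le)

lemma bounded_clinear_push: "inj h \<Longrightarrow> bounded_clinear (push h)"
  by (rule bounded_clinearI[where B = 1])
    (auto intro!: ell2_eqI simp: ell2_nth_push plus_ell2.rep_eq scaleC_ell2.rep_eq norm_push_le)

lemma pull_push: "inj h \<Longrightarrow> pull h (push h x) = x"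
  by (rule ell2_eqI) (simp add: ell2_nth_pull ell2_nth_push)

lemma pull_push_disjoint:
  assumes "inj h" "inj h'" "range h' \<inter> range h = {}"
  shows "pull h (push h' x) = 0"
  using assms by (intro ell2_eqI) (auto simp: ell2_nth_pull ell2_nth_push zero_ell2.rep_eq)

text \<open>Pulling back along \<open>h\<close> and along \<open>inv h\<close> are mutually inverse
  contractions, hence both are isometric.\<close>

lemma pull_bij:
  fixes x :: "('j, 'a :: chilbert_space) ell2" and h :: "'i \<Rightarrow> 'j"
  assumes "bij h"
  shows "norm (pull h x) = norm x" and "surj (pull h :: ('j, 'a) ell2 \<Rightarrow> _)"
proof -
  have i: "inj h" "inj (inv h)" using assms by (simp_all add: bij_is_inj bij_imp_bij_inv)
  have inv: "pull (inv h) (pull h y) = y" for y :: "('j, 'a) ell2"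
    by (rule ell2_eqI) (simp add: ell2_nth_pull i bij_is_surj[OF assms] surj_f_inv_f)
  have inv': "pull h (pull (inv h) y) = y" for y :: "('i, 'a) ell2"
    by (rule ell2_eqI) (simp add: ell2_nth_pull i)
  show "norm (pull h x) = norm x"
    using norm_pull_le[OF i(1), of x] norm_pull_le[OF i(2), of "pull h x"] by (simp add: inv)
  show "surj (pull h :: ('j, 'a) ell2 \<Rightarrow> _)"
    using inv' by (metis surjI)
qed

lemma cinner_push: "inj h \<Longrightarrow> cinner (push h x) (push h y) = cinner x y"
proof -
  assume h: "inj h"
  have "cinner (push h x) (push h y)
      = (\<Sum>\<^sub>\<infinity>j\<in>range h. cinner (ell2_nth (push h x) j) (ell2_nth (push h y) j))"
    unfolding cinner_ell2.rep_eq by (rule infsum_cong_neutral) (auto simp: ell2_nth_push h)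
  also have "\<dots> = cinner x y"
    by (simp add: infsum_reindex h o_def ell2_nth_push cinner_ell2.rep_eq)
  finally show ?thesis .
qed

lemma cinner_push_disjoint:
  assumes "inj h" "inj h'" "range h \<inter> range h' = {}"
  shows "cinner (push h x) (push h' y) = 0"
  unfolding cinner_ell2.rep_eq
  by (rule infsum_0) (use assms in \<open>auto simp: ell2_nth_push\<close>)


section \<open>An isometric dilation of the weighted shifts\<close>

definition step :: "'n \<Rightarrow> 'n list \<times> nat \<Rightarrow> 'n list \<times> nat"
  where "step i = (\<lambda>(\<gamma>, k). (i # \<gamma>, Suc k))"

lemma inj_step: "inj (step i)"
  by (auto simp: inj_def step_def)

lemma step_disjoint: "i \<noteq> j \<Longrightarrow> range (step i) \<inter> range (step j) = {}"
  by (auto simp: step_def)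

lemma ell2_nth_push_step:
  "ell2_nth (push (step i) x) (\<gamma>, k) = (case \<gamma> of [] \<Rightarrow> 0 | j # \<gamma>' \<Rightarrow>
    (case k of 0 \<Rightarrow> 0 | Suc k' \<Rightarrow> if j = i then ell2_nth x (\<gamma>', k') else 0))"
proof -
  have "inv (step i) (i # \<gamma>', Suc k') = (\<gamma>', k')" for \<gamma>' k'
    using inv_f_f[OF inj_step, of i "(\<gamma>', k')"] by (simp add: step_def)
  moreover have "(\<gamma>, k) \<in> range (step i) \<longleftrightarrow> (\<exists>\<gamma>' k'. \<gamma> = i # \<gamma>' \<and> k = Suc k')"
    by (auto simp: step_def image_iff)
  ultimately show ?thesis
    by (auto simp: ell2_nth_push inj_step split: list.split nat.split)
qed

text \<open>Purity comes from the word, not from the counter: each \<open>pull\<close> strips a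
  letter, and no position with the empty word lies in the range of any \<open>step i\<close>. In the
  induction, \<open>x\<close> varies because its components are other elements of
  \<open>Z\<close>.\<close>

interpretation step: pure_row_isometry
  "\<lambda>i :: 'n :: finite. push (step i) :: ('n list \<times> nat, 'k :: chilbert_space) ell2 \<Rightarrow> _"
  "\<lambda>i. pull (step i)"
proof
  fix i j :: 'n and x y :: "('n list \<times> nat, 'k) ell2" and Z :: "('n list \<times> nat, 'k) ell2 set"
  show "bounded_clinear (push (step i) :: ('n list \<times> nat, 'k) ell2 \<Rightarrow> _)"
    and "bounded_clinear (pull (step i) :: ('n list \<times> nat, 'k) ell2 \<Rightarrow> _)"
    by (simp_all add: bounded_clinear_push bounded_clinear_pull inj_step)
  show "pull (step j) (push (step i) x) = (if j = i then x else 0)"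
    by (simp add: pull_push pull_push_disjoint inj_step step_disjoint)
  show "cinner (push (step i) x) (push (step j) y) = (if i = j then cinner x y else 0)"
    by (simp add: cinner_push cinner_push_disjoint inj_step step_disjoint)
  assume Z: "\<And>x. x \<in> Z \<Longrightarrow>
    x = (\<Sum>i\<in>UNIV. push (step i) (pull (step i) x)) \<and> (\<forall>i. pull (step i) x \<in> Z)"
  have "ell2_nth x (\<gamma>, k) = 0" if "x \<in> Z" for x \<gamma> k
    using that
  proof (induction \<gamma> arbitrary: x k)
    case Nil
    then have "ell2_nth x ([], k) = ell2_nth (\<Sum>i\<in>UNIV. push (step i) (pull (step i) x)) ([], k)"
      by (intro arg_cong[where f = "\<lambda>y. ell2_nth y ([], k)"]) (use Z in blast)
    then show ?case by (simp add: ell2_nth_sum ell2_nth_push_step)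
  next
    case (Cons j \<gamma>)
    then have "ell2_nth x (j # \<gamma>, k)
        = ell2_nth (\<Sum>i\<in>UNIV. push (step i) (pull (step i) x)) (j # \<gamma>, k)"
      by (intro arg_cong[where f = "\<lambda>y. ell2_nth y (j # \<gamma>, k)"]) (use Z in blast)
    moreover have "ell2_nth (pull (step i) x) (\<gamma>, k') = 0" for i k'
      using Z Cons by blast
    ultimately show ?case by (cases k) (simp_all add: ell2_nth_sum ell2_nth_push_step)
  qed
  then have "x = 0" if "x \<in> Z" for x
    using that by (intro ell2_eqI) (auto simp: zero_ell2.rep_eq)
  then show "Z \<subseteq> {0}" by blast
qed

section \<open>The coefficients of the dilation and the coisometry \<open>P\<close>\<close>

locale contractive_weights =
  fixes b :: "'n :: finite list \<Rightarrow> real" and d :: real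
  assumes b_pos: "b \<alpha> > 0" and d_pos: "d > 0" and b_le: "b \<alpha> \<le> d * b (i # \<alpha>)"
begin

text \<open>
  On $e_\alpha \otimes e_\beta$ the canonical coisometry is
  $d^{-|\alpha|/2} W_\alpha (I - d^{-1} \sum_i W_i W_i^*)^{1/2} e_\beta = c_{\gamma, k} e_\gamma$,
  where $\gamma = \alpha\beta$ and $k = |\alpha|$.  Extending $c_{\gamma, k}$ by $0$ to $k > |\gamma|$
  makes all pairs $(\gamma, k)$ allowed, so that no factorization of $\gamma$ has to be carried
  along.
\<close>

definition u :: "'n list \<Rightarrow> nat \<Rightarrow> real"
  where "u \<gamma> k = (if k \<le> length \<gamma> then b (drop k \<gamma>) / (d ^ k * b \<gamma>) else 0)"

definition c :: "'n list \<Rightarrow> nat \<Rightarrow> real"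
  where "c \<gamma> k = sqrt (u \<gamma> k - u \<gamma> (Suc k))"

text \<open>\<open>u \<gamma> k\<close> is the diagonal entry at e_\<gamma> of d^(-k) times the sum
  of W_\<alpha> W_\<alpha>^* over words \<alpha> of length \<open>k\<close>. These operators
  decrease in \<open>k\<close> because the W_i / sqrt d form a row contraction; entrywise this is
  \<open>b_le\<close> for the letter \<open>\<gamma> ! k\<close>.\<close>

lemma u_antimono: "u \<gamma> (Suc k) \<le> u \<gamma> k"
proof (cases "Suc k \<le> length \<gamma>")
  case True
  then have "b (drop (Suc k) \<gamma>) \<le> d * b (drop k \<gamma>)"
    using b_le[of "drop (Suc k) \<gamma>" "\<gamma> ! k"] by (simp add: Cons_nth_drop_Suc)
  then have "b (drop (Suc k) \<gamma>) / (d ^ Suc k * b \<gamma>) \<le> d * b (drop k \<gamma>) / (d ^ Suc k * b \<gamma>)"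
    using b_pos[of \<gamma>] d_pos by (intro divide_right_mono) auto
  also have "\<dots> = b (drop k \<gamma>) / (d ^ k * b \<gamma>)" using d_pos by simp
  finally show ?thesis using True by (simp add: u_def)
next
  case False
  then show ?thesis using b_pos d_pos by (simp add: u_def less_imp_le)
qed

lemma c_square: "(c \<gamma> k)\<^sup>2 = u \<gamma> k - u \<gamma> (Suc k)"
  by (simp add: c_def u_antimono)

lemma c_eq_0: "k > length \<gamma> \<Longrightarrow> c \<gamma> k = 0"
  by (simp add: c_def u_def)

text \<open>The sum telescopes from \<open>u \<gamma> 0 = 1\<close> to the value 0 just past the
  length of \<gamma>. Thus the coefficients over each \<gamma> form a unit vector, which makes
  \<open>P\<close> a coisometry.\<close>

lemma sum_c_square: "(\<Sum>k\<le>length \<gamma>. (c \<gamma> k)\<^sup>2) = 1"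
proof -
  have "(\<Sum>k\<le>length \<gamma>. (c \<gamma> k)\<^sup>2) = u \<gamma> 0 - u \<gamma> (Suc (length \<gamma>))"
    unfolding c_square by (rule sum_telescope)
  then show ?thesis using b_pos[of \<gamma>] by (simp add: u_def)
qed

lemma sum_c_square_le: "finite K \<Longrightarrow> (\<Sum>k\<in>K. (c \<gamma> k)\<^sup>2) \<le> 1"
proof -
  assume K: "finite K"
  have "(\<Sum>k\<in>K. (c \<gamma> k)\<^sup>2) = (\<Sum>k\<in>K \<inter> {..length \<gamma>}. (c \<gamma> k)\<^sup>2)"
    using K by (intro sum.mono_neutral_right) (auto, meson c_eq_0 not_le)
  also have "\<dots> \<le> (\<Sum>k\<le>length \<gamma>. (c \<gamma> k)\<^sup>2)" by (intro sum_mono2) auto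
  finally show ?thesis by (simp add: sum_c_square)
qed

text \<open>The intertwining relation at the level of coefficients: the common prefix length grows
  by one together with the word, so that only the weight of W_i, divided by sqrt d, is left
  over.\<close>

lemma c_Cons: "c (i # \<gamma>) (Suc k) = sqrt (b \<gamma> / b (i # \<gamma>)) / sqrt d * c \<gamma> k"
proof -
  have "u (i # \<gamma>) (Suc m) = b \<gamma> / b (i # \<gamma>) / d * u \<gamma> m" for m
    using b_pos[of \<gamma>] by (simp add: u_def)
  then have "u (i # \<gamma>) (Suc k) - u (i # \<gamma>) (Suc (Suc k))
      = b \<gamma> / b (i # \<gamma>) / d * (u \<gamma> k - u \<gamma> (Suc k))"
    by (simp only: right_diff_distrib)
  then show ?thesis
    unfolding c_def by (simp only: real_sqrt_mult real_sqrt_divide)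
qed

definition P :: "('n list \<times> nat, 'k :: chilbert_space) ell2 \<Rightarrow> ('n, 'k) fock"
  where "P x = Abs_ell2 (\<lambda>\<gamma>. \<Sum>k\<le>length \<gamma>. c \<gamma> k *\<^sub>R ell2_nth x (\<gamma>, k))"

text \<open>The adjoint of \<open>P\<close>, which is an isometric embedding. Only
  \<open>P_J\<close> and the bound \<open>norm_J_le\<close> are needed from it.\<close>

definition J :: "('n, 'k :: chilbert_space) fock \<Rightarrow> ('n list \<times> nat, 'k) ell2"
  where "J x = Abs_ell2 (\<lambda>(\<gamma>, k). c \<gamma> k *\<^sub>R ell2_nth x \<gamma>)"

text \<open>Cauchy-Schwarz in the fibre over each \<gamma>, against the unit vector
  \<open>c \<gamma>\<close>; distinct \<gamma> use disjoint coordinates of \<open>x\<close>.\<close>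

lemma
  shows ell2_nth_P: "ell2_nth (P x) = (\<lambda>\<gamma>. \<Sum>k\<le>length \<gamma>. c \<gamma> k *\<^sub>R ell2_nth x (\<gamma>, k))"
    and norm_P_le: "norm (P x) \<le> norm x"
proof -
  let ?f = "\<lambda>\<gamma>. \<Sum>k\<le>length \<gamma>. c \<gamma> k *\<^sub>R ell2_nth x (\<gamma>, k)"
  have le: "(norm (?f \<gamma>))\<^sup>2 \<le> (\<Sum>k\<le>length \<gamma>. (norm (ell2_nth x (\<gamma>, k)))\<^sup>2)" for \<gamma>
  proof -
    let ?K = "{..length \<gamma>}"
    have "norm (?f \<gamma>) \<le> (\<Sum>k\<in>?K. \<bar>c \<gamma> k\<bar> * \<bar>norm (ell2_nth x (\<gamma>, k))\<bar>)"
      by (rule order_trans[OF norm_sum]) simp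
    also have "\<dots> \<le> L2_set (c \<gamma>) ?K * L2_set (\<lambda>k. norm (ell2_nth x (\<gamma>, k))) ?K"
      by (rule L2_set_mult_ineq)
    also have "\<dots> = sqrt (\<Sum>k\<le>length \<gamma>. (norm (ell2_nth x (\<gamma>, k)))\<^sup>2)"
      by (simp add: L2_set_def sum_c_square)
    finally show ?thesis by (simp add: real_le_rsqrt sqrt_ge_absD)
  qed
  have "L2_set (\<lambda>\<gamma>. norm (?f \<gamma>)) F \<le> norm x" if F: "finite F" for F
  proof -
    have "(\<Sum>\<gamma>\<in>F. (norm (?f \<gamma>))\<^sup>2) \<le> (\<Sum>\<gamma>\<in>F. \<Sum>k\<le>length \<gamma>. (norm (ell2_nth x (\<gamma>, k)))\<^sup>2)"
      by (rule sum_mono) (rule le)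
    also have "\<dots> = (\<Sum>p\<in>(SIGMA \<gamma>:F. {..length \<gamma>}). (norm (ell2_nth x p))\<^sup>2)"
      using F by (simp add: sum.Sigma split_beta)
    finally have "L2_set (\<lambda>\<gamma>. norm (?f \<gamma>)) F
        \<le> L2_set (\<lambda>p. norm (ell2_nth x p)) (SIGMA \<gamma>:F. {..length \<gamma>})"
      by (simp add: L2_set_def)
    also have "\<dots> \<le> norm x" using F by (intro L2_set_le_norm_ell2) auto
    finally show ?thesis .
  qed
  note * = ell2_nth_Abs_ell2[OF this]
  show "ell2_nth (P x) = ?f" and "norm (P x) \<le> norm x"
    unfolding P_def by (simp_all add: *)
qed

lemma
  shows ell2_nth_J: "ell2_nth (J x) (\<gamma>, k) = c \<gamma> k *\<^sub>R ell2_nth x \<gamma>"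
    and norm_J_le: "norm (J x) \<le> norm x"
proof -
  let ?f = "\<lambda>(\<gamma>, k). c \<gamma> k *\<^sub>R ell2_nth x \<gamma>"
  have "L2_set (\<lambda>p. norm (?f p)) F \<le> norm x" if F: "finite F" for F
  proof -
    \<comment> \<open>Enlarging \<open>F\<close> to a rectangle makes the sum iterated, so each
      fibre contributes at most 1 times the squared norm of one coordinate.\<close>
    have "(\<Sum>p\<in>F. (norm (?f p))\<^sup>2) \<le> (\<Sum>p\<in>fst ` F \<times> snd ` F. (norm (?f p))\<^sup>2)"
      using F by (intro sum_mono2) (auto simp: subset_fst_snd)
    also have "\<dots> = (\<Sum>\<gamma>\<in>fst ` F. (\<Sum>k\<in>snd ` F. (c \<gamma> k)\<^sup>2) * (norm (ell2_nth x \<gamma>))\<^sup>2)"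
      by (simp add: sum.cartesian_product' power_mult_distrib sum_distrib_right)
    also have "\<dots> \<le> (\<Sum>\<gamma>\<in>fst ` F. 1 * (norm (ell2_nth x \<gamma>))\<^sup>2)"
      using F by (intro sum_mono mult_right_mono sum_c_square_le) auto
    finally have "L2_set (\<lambda>p. norm (?f p)) F \<le> L2_set (\<lambda>\<gamma>. norm (ell2_nth x \<gamma>)) (fst ` F)"
      by (simp add: L2_set_def)
    also have "\<dots> \<le> norm x" using F by (intro L2_set_le_norm_ell2) auto
    finally show ?thesis .
  qed
  note * = ell2_nth_Abs_ell2[OF this]
  show "ell2_nth (J x) (\<gamma>, k) = c \<gamma> k *\<^sub>R ell2_nth x \<gamma>" and "norm (J x) \<le> norm x"
    unfolding J_def by (simp_all add: *)
qed

lemma bounded_clinear_P: "bounded_clinear P"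
proof (rule bounded_clinearI[where B = 1])
  show "P (x + y) = P x + P y" for x y :: "('n list \<times> nat, 'k :: chilbert_space) ell2"
    by (rule ell2_eqI) (simp add: ell2_nth_P plus_ell2.rep_eq scaleR_add_right sum.distrib)
  show "P (a *\<^sub>C x) = a *\<^sub>C P x" for a and x :: "('n list \<times> nat, 'k :: chilbert_space) ell2"
    by (rule ell2_eqI) (simp add: ell2_nth_P scaleC_ell2.rep_eq complex_vector.scale_sum_right
      mult.commute[of a] scaleC_scaleC flip: scaleC_of_real)
qed (simp add: norm_P_le)

lemma P_J: "P (J x) = x"
proof (rule ell2_eqI)
  fix \<gamma>
  have "ell2_nth (P (J x)) \<gamma> = (\<Sum>k\<le>length \<gamma>. (c \<gamma> k)\<^sup>2) *\<^sub>R ell2_nth x \<gamma>"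
    by (simp add: ell2_nth_P ell2_nth_J scaleR_sum_left power2_eq_square)
  then show "ell2_nth (P (J x)) \<gamma> = ell2_nth x \<gamma>" by (simp add: sum_c_square)
qed

text \<open>Since \<open>z - J (P z)\<close> lies in ker P, the squared norm of \<open>z\<close>
  equals <z, J (P z)>, which is at most |z| |P z| because \<open>J\<close> is contractive.\<close>

lemma norm_P_eq:
  assumes "\<And>y. P y = 0 \<Longrightarrow> cinner z y = 0"
  shows "norm (P z) = norm z"
proof (rule antisym[OF norm_P_le])
  have "P (z - J (P z)) = 0" by (simp add: bounded_clinearD[OF bounded_clinear_P] P_J)
  then have "cinner z (z - J (P z)) = 0" by (rule assms)
  then have "cinner z z = cinner z (J (P z))" by (simp add: cinner_diff_right)
  then have "complex_of_real ((norm z)\<^sup>2) = cinner z (J (P z))"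
    by (simp only: norm_square_eq_cinner)
  then have "(norm z)\<^sup>2 = Re (cinner z (J (P z)))" by (metis Re_complex_of_real)
  also have "\<dots> \<le> norm z * norm (J (P z))" by (rule Re_cinner_le)
  also have "\<dots> \<le> norm z * norm (P z)" by (intro mult_left_mono norm_J_le) simp
  finally show "norm z \<le> norm (P z)" by (cases "z = 0") (simp_all add: power2_eq_square)
qed

lemma bdd_above_weights: "bdd_above (range (\<lambda>\<alpha>. b \<alpha> / b (i # \<alpha>)))"
  by (rule bdd_aboveI2[where M = d]) (use b_pos b_le in \<open>simp add: pos_divide_le_eq\<close>)

lemma P_push_step: "sqrt d *\<^sub>R P (push (step i) x) = tensor_id (universal_model b i) (P x)"
proof (rule ell2_eqI)
  fix \<beta>
  \<comment> \<open>The pushed vector vanishes at counter 0, so the sum up to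
    \<open>length \<beta>\<close> loses its first term and, shifted by one, runs up to
    \<open>length \<alpha>\<close>.\<close>
  have "ell2_nth (P (push (step i) x)) \<beta> =
      (case \<beta> of [] \<Rightarrow> 0 | j # \<alpha> \<Rightarrow> if j = i then
        (\<Sum>k\<le>length \<alpha>. c \<beta> (Suc k) *\<^sub>R ell2_nth x (\<alpha>, k)) else 0)"
    by (cases \<beta>)
      (simp_all add: ell2_nth_P ell2_nth_push_step sum.atMost_Suc_shift del: sum.atMost_Suc)
  then show "ell2_nth (sqrt d *\<^sub>R P (push (step i) x)) \<beta>
      = ell2_nth (tensor_id (universal_model b i) (P x)) \<beta>"
    using d_pos
    by (simp add: scaleR_ell2.rep_eq tensor_id_universal_model[OF b_pos bdd_above_weights]
      ell2_nth_P[of x] c_Cons scaleR_sum_right split: list.split)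
qed

end

section \<open>The characterization of invariant subspaces\<close>

lemma model_invariant_if_image:
  fixes M :: "('n :: finite, 'k :: chilbert_space) fock set"
  assumes M: "csubspace M" and D: "csubspace D"
    and eq: "M = \<Psi> ` fock_tensor D"
    and inter: "\<And>\<phi>. \<phi> \<in> fock_tensor D \<Longrightarrow>
      r *\<^sub>R \<Psi> (tensor_id (left_creation i) \<phi>) = T (\<Psi> \<phi>)"
  shows "T ` M \<subseteq> M"
proof (rule image_subsetI)
  fix x assume "x \<in> M"
  then obtain \<phi> where \<phi>: "\<phi> \<in> fock_tensor D" "x = \<Psi> \<phi>" using eq by blast
  have "\<Psi> (tensor_id (left_creation i) \<phi>) \<in> M"
    unfolding eq using tensor_id_left_creation_in_fock_tensor[OF D \<phi>(1)] by blast
  then show "T x \<in> M" using csubspace_scaleR[OF M] by (simp add: \<phi> flip: inter)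
qed

lemma ex_bij_list_nat: "\<exists>e :: 'n :: finite list \<times> nat \<Rightarrow> 'n list. bij e"
proof -
  have "bij_betw (from_nat_into UNIV) UNIV (UNIV :: 'n list set)"
    by (rule bij_betw_from_nat_into) (simp_all add: infinite_UNIV_listI)
  moreover have "bij_betw (to_nat_on UNIV) (UNIV :: ('n list \<times> nat) set) UNIV"
    by (rule to_nat_on_infinite) (simp_all add: finite_prod)
  ultimately show ?thesis using bij_betw_trans by blast
qed

text \<open>A formula cannot quantify over types, so the existence of a Hilbert space is expressed
  in two parts. For necessity, the multiplicity space is found as a closed subspace of the fixed
  space \<open>('n, 'k) fock\<close>; sufficiency is asserted for closed subspaces of an arbitrary
  Hilbert space \<open>'d\<close>.\<close>

theorem theorem2p7:
  fixes b :: "'n :: finite list \<Rightarrow> real"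
    and M :: "('n, 'k :: chilbert_space) fock set"
  defines "d \<equiv> Sup {b \<alpha> / b (i # \<alpha>) | \<alpha> i. True}"
  assumes "admissible b"
    and "csubspace M" and "closed M"
  shows "((\<forall>i. tensor_id (universal_model b i) ` M \<subseteq> M) \<longleftrightarrow>
      (\<exists>(D :: ('n, 'k) fock set) (\<Psi> :: ('n, ('n, 'k) fock) fock \<Rightarrow> ('n, 'k) fock).
        csubspace D \<and> closed D \<and> partial_isometry_on (fock_tensor D) \<Psi> \<and>
        M = \<Psi> ` fock_tensor D \<and>
        (\<forall>i. \<forall>\<phi>\<in>fock_tensor D. sqrt d *\<^sub>R \<Psi> (tensor_id (left_creation i) \<phi>)
          = tensor_id (universal_model b i) (\<Psi> \<phi>)))) \<and>
    ((\<exists>(D :: 'd :: chilbert_space set) (\<Psi> :: ('n, 'd) fock \<Rightarrow> ('n, 'k) fock).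
        csubspace D \<and> closed D \<and> partial_isometry_on (fock_tensor D) \<Psi> \<and>
        M = \<Psi> ` fock_tensor D \<and>
        (\<forall>i. \<forall>\<phi>\<in>fock_tensor D. sqrt d *\<^sub>R \<Psi> (tensor_id (left_creation i) \<phi>)
          = tensor_id (universal_model b i) (\<Psi> \<phi>))) \<longrightarrow>
      (\<forall>i. tensor_id (universal_model b i) ` M \<subseteq> M))"
    (is "((\<forall>i. ?inv i) \<longleftrightarrow> ?ex) \<and> (?ex' \<longrightarrow> (\<forall>i. ?inv i))")
proof (intro conjI iffI impI allI)
  show "?inv i" if ?ex for i
    using that \<open>csubspace M\<close>
    by (elim exE conjE) (rule model_invariant_if_image[where r = "sqrt d" and i = i], auto)
  show "?inv i" if ?ex' for i
    using that \<open>csubspace M\<close>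
    by (elim exE conjE) (rule model_invariant_if_image[where r = "sqrt d" and i = i], auto)
next
  assume inv: "\<forall>i. ?inv i"
  have pos: "b \<alpha> > 0" and bdd: "bdd_above (range (\<lambda>\<alpha>. b \<alpha> / b (i # \<alpha>)))" for \<alpha> i
    using \<open>admissible b\<close> by (auto simp: admissible_def)
  have "{b \<alpha> / b (i # \<alpha>) | \<alpha> i. True} = (\<Union>i. range (\<lambda>\<alpha>. b \<alpha> / b (i # \<alpha>)))" by auto
  then have "bdd_above {b \<alpha> / b (i # \<alpha>) | \<alpha> i. True}" using bdd by (simp add: bdd_above_UN)
  then have le: "b \<alpha> / b (i # \<alpha>) \<le> d" for \<alpha> i
    unfolding d_def by (intro cSup_upper) auto
  interpret contractive_weights b d
  proof
    show "d > 0" using le[of "[]"] pos[of "[]"] pos[of "[_]"] by (meson divide_pos_pos less_le_trans)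
    show "b \<alpha> \<le> d * b (i # \<alpha>)" for \<alpha> i using le[of \<alpha> i] pos by (simp add: pos_divide_le_eq)
  qed (rule pos)
  define N :: "('n list \<times> nat, 'k) ell2 set" where "N = P -` M"
  \<comment> \<open>a bijection, because \<open>D\<close> must consist of vectors of \<open>('n, 'k) fock\<close>\<close>
  obtain e :: "'n list \<times> nat \<Rightarrow> 'n list" where e: "bij e" using ex_bij_list_nat by blast
  interpret invariant_subspace "\<lambda>i :: 'n. push (step i)" "\<lambda>i. pull (step i)" N
    "pull e :: ('n, 'k) fock \<Rightarrow> ('n list \<times> nat, 'k) ell2"
  proof
    show "csubspace N" "closed N"
      unfolding N_def by (intro csubspace_vimage closed_vimage_clinear bounded_clinear_P assms)+
    show "push (step i) x \<in> N" if "x \<in> N" for i x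
    proof -
      have "P (push (step i) x) = (1 / sqrt d) *\<^sub>R tensor_id (universal_model b i) (P x)"
        using d_pos by (simp flip: P_push_step)
      also have "\<dots> \<in> M" using that inv by (intro csubspace_scaleR assms) (auto simp: N_def)
      finally show ?thesis by (simp add: N_def)
    qed
  qed (use e in \<open>simp_all add: bounded_clinear_pull bij_is_inj pull_bij\<close>)
  have sF: "csubspace (fock_tensor D :: ('n, ('n, 'k) fock) fock set)"
    by (rule csubspace_fock_tensor[OF csubspace_D])
  have iso: "partial_isometry_on (fock_tensor D) (\<lambda>\<phi>. P (wold \<phi>))"
    unfolding partial_isometry_on_def
  proof (intro conjI ballI allI impI)
    show "\<exists>B. \<forall>x\<in>fock_tensor D. norm (P (wold x)) \<le> B * norm x"
      by (rule exI[of _ 1]) (metis mult_1 norm_P_le norm_wold)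
    fix x assume x: "x \<in> fock_tensor D"
      and orth: "\<forall>y\<in>fock_tensor D. P (wold y) = 0 \<longrightarrow> cinner x y = 0"
    \<comment> \<open>Here \<open>N\<close> being a full preimage enters: ker P is contained in
      \<open>N\<close>, the range of \<open>wold\<close>, so the hypothesis on \<open>x\<close>
      gives orthogonality to all of ker P, as \<open>norm_P_eq\<close> demands.\<close>
    have "cinner (wold x) z = 0" if "P z = 0" for z
    proof -
      have "z \<in> N" using that complex_vector.subspace_0[OF \<open>csubspace M\<close>] by (simp add: N_def)
      then obtain y where "y \<in> fock_tensor D" "z = wold y" using wold_onto by blast
      then show ?thesis using orth x that by (simp add: cinner_wold)
    qed
    then show "norm (P (wold x)) = norm x" using norm_wold[OF x] norm_P_eq by metis
  qed (simp_all add: wold_add wold_scaleC bounded_clinearD[OF bounded_clinear_P])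
  have "P ` N = M" unfolding N_def by (rule surj_image_vimage_eq[OF surjI[where f = J, OF P_J]])
  then have onto: "M = (\<lambda>\<phi>. P (wold \<phi>)) ` fock_tensor D"
    using wold_onto by (metis image_image)
  have "\<forall>i. \<forall>\<phi>\<in>fock_tensor D. sqrt d *\<^sub>R P (wold (tensor_id (left_creation i) \<phi>))
      = tensor_id (universal_model b i) (P (wold \<phi>))"
    by (simp add: wold_left_creation P_push_step)
  with iso onto csubspace_D closed_D show ?ex by blast
qed

end
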